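(* Let $p:\mathbb{C}^n\to\mathbb{C}$ be a polynomial with integer coefficients and zero constant term. Then $p$ is accurately evaluable on $\mathcal{D}=\mathbb{C}^n$ (in traditional arithmetic) if and only if the variety $V(p)=\{z\in\mathbb{C}^n: p(z)=0\}$ is allowable.
   Context: Allowable sets. The allowable hyperplanes in $\mathbb{C}^n$ are $Z_i=\{x: x_i=0\}$, $S_{ij}=\{x: x_i+x_j=0\}$ and $D_{ij}=\{x: x_i-x_j=0\}$ ($i\neq j$). A variety $V(p)$ is allowable if it is a (finite) union of intersections of allowable hyperplanes. Traditional arithmetic. An algorithm receives the input $x=(x_1,\dots,x_n)\in\mathbb{C}^n$ exactly and is a finite directed acyclic graph with input, computational, branching and output nodes. Each computational node takes two inputs $a,b$ (which may come from the same node), performs one operation $op\in\{+,-,\times\}$, and returns $op(a,b)(1+\delta_i)$, where $\delta_i\in\mathbb{C}$ is a rounding error attached to that node; the $\delta_i$ of different nodes are independent variables (nondeterministic model). Negation is also available and is exact. No constants are available. The algorithm may or may not use comparisons and branching. It always terminates in finitely many steps; its output is denoted $p_{comp}(x,\delta)$, where $\delta=(\delta_1,\dots,\delta_k)$ is the vector of rounding errors, and it computes $p$ exactly when there is no rounding error: $p_{comp}(x,0)=p(x)$. Accuracy. The algorithm is accurate for $p$ on $\mathcal{D}$ if for every $0<\eta<1$ there is $0<\epsilon<1$ such that for all $x\in\mathcal{D}$ and all $\delta$ with $|\delta_i|\le\epsilon$ for every $i$, $|p_{comp}(x,\delta)-p(x)|\le\eta\,|p(x)|$. The polynomial $p$ is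 accurately evaluable on $\mathcal{D}$ if there exists an accurate algorithm for $p$ on $\mathcal{D}$. *)

theory Defs
  imports "HOL-Analysis.Analysis" "HOL-Library.Poly_Mapping"
begin

section \<open>Polynomials with integer coefficients\<close>

text \<open>An integer polynomial in the variables \<open>x $ i\<close> is a finitely supported map from
  exponent vectors to coefficients; its constant term is the coefficient at exponent \<open>0\<close>.\<close>

type_synonym 'n int_mpoly = "('n \<Rightarrow>\<^sub>0 nat) \<Rightarrow>\<^sub>0 int"

definition eval_mpoly :: "'n::finite int_mpoly \<Rightarrow> complex ^ 'n \<Rightarrow> complex" where
  "eval_mpoly p x =
     (\<Sum>m \<in> Poly_Mapping.keys p. of_int (Poly_Mapping.lookup p m) *
        (\<Prod>i\<in>UNIV. x $ i ^ Poly_Mapping.lookup m i))"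

definition variety :: "'n::finite int_mpoly \<Rightarrow> (complex ^ 'n) set" where
  "variety p = {z. eval_mpoly p z = 0}"

section \<open>Allowable sets\<close>

definition hyp_Z :: "'n::finite \<Rightarrow> (complex ^ 'n) set" where
  "hyp_Z i = {x. x $ i = 0}"

definition hyp_S :: "'n::finite \<Rightarrow> 'n \<Rightarrow> (complex ^ 'n) set" where
  "hyp_S i j = {x. x $ i + x $ j = 0}"

definition hyp_D :: "'n::finite \<Rightarrow> 'n \<Rightarrow> (complex ^ 'n) set" where
  "hyp_D i j = {x. x $ i - x $ j = 0}"

definition allowable_hyperplanes :: "(complex ^ 'n::finite) set set" where
  "allowable_hyperplanes =
     {hyp_Z i | i. True} \<union> {hyp_S i j | i j. i \<noteq> j} \<union> {hyp_D i j | i j. i \<noteq> j}"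

text \<open>The empty intersection counts as the whole space, so that the variety of the
  zero polynomial is allowable.\<close>

definition allowable :: "(complex ^ 'n::finite) set \<Rightarrow> bool" where
  "allowable V \<longleftrightarrow>
     (\<exists>F. finite F \<and> (\<forall>C\<in>F. C \<subseteq> allowable_hyperplanes) \<and> V = (\<Union>C\<in>F. \<Inter>C))"

section \<open>Algorithms in traditional arithmetic\<close>

text \<open>The nodes of an algorithm are the input nodes \<open>Inp i\<close>, carrying \<open>x $ i\<close>, and finitely
  many numbered nodes, of which number 0 is executed first.  The operands of a node are other
  nodes (data edges); its trailing \<open>nat\<close> arguments are the nodes that may be executed next
  (control edges).  \<open>Branch a b s t\<close> continues with \<open>s\<close> if the values of \<open>a\<close> and \<open>b\<close> are equal
  and with \<open>t\<close> otherwise; equality is the only comparison available for complex numbers, and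
  it is decided exactly.\<close>

datatype arith = Plus | Minus | Times

datatype 'n operand = Inp 'n | Nd nat

datatype 'n node =
    Compute arith "'n operand" "'n operand" nat
  | Negate "'n operand" nat
  | Branch "'n operand" "'n operand" nat nat
  | Output "'n operand"

type_synonym 'n graph = "'n node list"

fun arith_op :: "arith \<Rightarrow> complex \<Rightarrow> complex \<Rightarrow> complex" where
  "arith_op Plus u v = u + v"
| "arith_op Minus u v = u - v"
| "arith_op Times u v = u * v"

fun operands :: "'n node \<Rightarrow> 'n operand set" where
  "operands (Compute f a b s) = {a, b}"
| "operands (Negate a s) = {a}"
| "operands (Branch a b s t) = {a, b}"
| "operands (Output a) = {a}"

fun successors :: "'n node \<Rightarrow> nat set" where
  "successors (Compute f a b s) = {s}"
| "successors (Negate a s) = {s}"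
| "successors (Branch a b s t) = {s, t}"
| "successors (Output a) = {}"

definition edges :: "'n graph \<Rightarrow> (nat \<times> nat) set" where
  "edges A = {(k, s). k < length A \<and> s \<in> successors (A ! k)} \<union>
             {(m, k). k < length A \<and> Nd m \<in> operands (A ! k)}"

definition dag :: "'n graph \<Rightarrow> bool" where
  "dag A \<longleftrightarrow> edges A \<subseteq> {..<length A} \<times> {..<length A} \<and> acyclic (edges A)"

text \<open>The map \<open>\<sigma>\<close> holds the values of the numbered nodes executed so far.\<close>

fun operand_value :: "complex ^ 'n::finite \<Rightarrow> (nat \<rightharpoonup> complex) \<Rightarrow> 'n operand \<Rightarrow> complex option" where
  "operand_value x \<sigma> (Inp i) = Some (x $ i)"
| "operand_value x \<sigma> (Nd m) = \<sigma> m"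

text \<open>\<open>returns A x \<delta> k \<sigma> y\<close>: execution of \<open>A\<close> on input \<open>x\<close> with rounding errors \<open>\<delta>\<close>, resumed
  at node \<open>k\<close> with \<open>\<sigma>\<close> computed so far, ends with output \<open>y\<close>.  Execution gets stuck, without
  output, when it needs the value of a node that has not been executed.\<close>

inductive returns ::
  "'n::finite graph \<Rightarrow> complex ^ 'n \<Rightarrow> (nat \<Rightarrow> complex) \<Rightarrow> nat \<Rightarrow> (nat \<rightharpoonup> complex) \<Rightarrow> complex \<Rightarrow> bool"
  for A :: "'n::finite graph" and x :: "complex ^ 'n" and \<delta> :: "nat \<Rightarrow> complex"
where
  compute: "\<lbrakk>k < length A; A ! k = Compute f a b s;
      operand_value x \<sigma> a = Some u; operand_value x \<sigma> b = Some v;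
      returns A x \<delta> s (\<sigma>(k \<mapsto> arith_op f u v * (1 + \<delta> k))) y\<rbrakk> \<Longrightarrow> returns A x \<delta> k \<sigma> y"
| negate: "\<lbrakk>k < length A; A ! k = Negate a s; operand_value x \<sigma> a = Some u;
      returns A x \<delta> s (\<sigma>(k \<mapsto> - u)) y\<rbrakk> \<Longrightarrow> returns A x \<delta> k \<sigma> y"
| branch: "\<lbrakk>k < length A; A ! k = Branch a b s t;
      operand_value x \<sigma> a = Some u; operand_value x \<sigma> b = Some v;
      returns A x \<delta> (if u = v then s else t) \<sigma> y\<rbrakk> \<Longrightarrow> returns A x \<delta> k \<sigma> y"
| out: "\<lbrakk>k < length A; A ! k = Output a; operand_value x \<sigma> a = Some y\<rbrakk>
      \<Longrightarrow> returns A x \<delta> k \<sigma> y"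

lemma returns_unique:
  assumes "returns A x \<delta> k \<sigma> y" and "returns A x \<delta> k \<sigma> y'"
  shows "y = y'"
  using assms
proof (induction arbitrary: y' rule: returns.induct)
  case (compute k f a b s \<sigma> u v y)
  from compute.prems show ?case
    by (cases rule: returns.cases) (use compute.hyps in \<open>auto intro: compute.IH simp del: fun_upd_apply\<close>)
next
  case (negate k a s \<sigma> u y)
  from negate.prems show ?case
    by (cases rule: returns.cases) (use negate.hyps in \<open>auto intro: negate.IH simp del: fun_upd_apply\<close>)
next
  case (branch k a b s t \<sigma> u v y)
  from branch.prems show ?case
    by (cases rule: returns.cases) (use branch.hyps in \<open>auto intro: branch.IH simp del: fun_upd_apply\<close>)
next
  case (out k a \<sigma> y)
  from out.prems show ?case
    by (cases rule: returns.cases) (use out.hyps in auto)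
qed

definition algorithm :: "'n::finite graph \<Rightarrow> bool" where
  "algorithm A \<longleftrightarrow> dag A \<and> (\<forall>x \<delta>. \<exists>y. returns A x \<delta> 0 Map.empty y)"

definition p_comp :: "'n::finite graph \<Rightarrow> complex ^ 'n \<Rightarrow> (nat \<Rightarrow> complex) \<Rightarrow> complex" where
  "p_comp A x \<delta> = (THE y. returns A x \<delta> 0 Map.empty y)"

section \<open>Accuracy\<close>

definition algorithm_for :: "'n::finite graph \<Rightarrow> (complex ^ 'n \<Rightarrow> complex) \<Rightarrow> bool" where
  "algorithm_for A p \<longleftrightarrow> algorithm A \<and> (\<forall>x. p_comp A x (\<lambda>_. 0) = p x)"

definition accurate_on ::
  "'n::finite graph \<Rightarrow> (complex ^ 'n \<Rightarrow> complex) \<Rightarrow> (complex ^ 'n) set \<Rightarrow> bool" where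
  "accurate_on A p D \<longleftrightarrow>
     (\<forall>\<eta>::real. 0 < \<eta> \<and> \<eta> < 1 \<longrightarrow>
       (\<exists>\<epsilon>::real. 0 < \<epsilon> \<and> \<epsilon> < 1 \<and>
         (\<forall>x\<in>D. \<forall>\<delta>. (\<forall>i<length A. cmod (\<delta> i) \<le> \<epsilon>) \<longrightarrow>
            cmod (p_comp A x \<delta> - p x) \<le> \<eta> * cmod (p x))))"

definition accurately_evaluable ::
  "(complex ^ 'n::finite \<Rightarrow> complex) \<Rightarrow> (complex ^ 'n) set \<Rightarrow> bool" where
  "accurately_evaluable p D \<longleftrightarrow> (\<exists>A. algorithm_for A p \<and> accurate_on A p D)"

end

theory Submission
  imports Defs "HOL-Computational_Algebra.Fundamental_Theorem_Algebra"
begin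

text \<open>
  The equivalence rests on one analytic fact about rounding and one algebraic fact about
  polynomials over an algebraically closed field.

  Suppose an accurate algorithm exists.  Call two inputs alike if the same coordinates, sums of
  two coordinates and differences of two coordinates vanish on them.  Run the algorithm on
  two alike inputs with the same rounding errors, choosing each error generically when its node
  is reached.  A rounded nonzero result then differs from everything computed before, up to sign,
  so a computed value vanishes, or agrees up to sign with another one, only for reasons shared by
  both inputs.  Hence both runs take the same branches, and both outputs vanish or neither does
  (\<open>similar_runs\<close>).  Accuracy forces the output to vanish exactly where \<open>p\<close> does, even in the
  presence of rounding, so the variety is a union of classes of alike inputs
  (\<open>accurate_zero_transfer\<close>).  A polynomial that vanishes on such a class vanishes on the
  intersection of all allowable hyperplanes through it, because the class is what remains of that
  linear space after the removal of finitely many proper subspaces.  There are only finitely many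
  such intersections (\<open>allowable_if_vanishing_transfers\<close>).

  Conversely, let the variety be allowable and \<open>p \<noteq> 0\<close>.  Every zero of \<open>p\<close> then lies on one of
  finitely many hyperplanes.  Either \<open>p\<close> vanishes on a whole hyperplane, and its linear form
  can be divided out, or a generic line in a generic direction meets all the hyperplanes outside
  the zero set, so that \<open>p\<close> has no zero on it and is constant there by the fundamental theorem of
  algebra.  Hence \<open>p\<close> is a constant times a product of allowable forms (\<open>factorization\<close>).
  The constant is an integer, because the forms have leading coefficients \<open>1\<close> or \<open>-1\<close> along a
  suitable monomial curve (\<open>factorization_integer\<close>).  The vanishing of \<open>p\<close> at the origin provides
  at least one factor.  The forms are computed from exact inputs with a single rounding,
  products preserve small relative errors, and the integer multiple is built up by repeatedly
  adding or subtracting the product, which involves no cancellation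
  (\<open>computable_int_multiple\<close>).
\<close>

section \<open>Generic runs on inputs with the same vanishing forms\<close>

text \<open>Two states of execution are similar if no test for a vanishing value, or for agreement of two
  values up to sign, tells them apart.  Signs are included because sums and exact negations turn
  agreement up to sign into vanishing and into equality.\<close>

definition similar ::
  "complex ^ 'n::finite \<Rightarrow> (nat \<rightharpoonup> complex) \<Rightarrow> complex ^ 'n \<Rightarrow> (nat \<rightharpoonup> complex) \<Rightarrow> bool" where
  "similar x \<sigma> y \<tau> \<longleftrightarrow> dom \<sigma> = dom \<tau> \<and>
     (\<forall>a b u v u' v'.
        operand_value x \<sigma> a = Some u \<longrightarrow> operand_value x \<sigma> b = Some v \<longrightarrow>
        operand_value y \<tau> a = Some u' \<longrightarrow> operand_value y \<tau> b = Some v' \<longrightarrow>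
        (u = 0 \<longleftrightarrow> u' = 0) \<and> (u = v \<longleftrightarrow> u' = v') \<and> (u = - v \<longleftrightarrow> u' = - v'))"

lemma similarD:
  assumes "similar x \<sigma> y \<tau>"
    and "operand_value x \<sigma> a = Some u" "operand_value x \<sigma> b = Some v"
    and "operand_value y \<tau> a = Some u'" "operand_value y \<tau> b = Some v'"
  shows "u = 0 \<longleftrightarrow> u' = 0" "u = v \<longleftrightarrow> u' = v'" "u = - v \<longleftrightarrow> u' = - v'"
  using assms unfolding similar_def by blast+

lemma similar_defined:
  assumes "similar x \<sigma> y \<tau>" "operand_value x \<sigma> a = Some u"
  obtains u' where "operand_value y \<tau> a = Some u'"
proof (cases a)
  case (Nd m)
  then have "m \<in> dom \<tau>" using assms unfolding similar_def by auto
  then show ?thesis using that Nd by auto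
qed (use that in simp)

lemma similar_update:
  assumes sim: "similar x \<sigma> y \<tau>" and zero: "w = 0 \<longleftrightarrow> w' = 0"
    and new: "\<And>b v v'. operand_value x \<sigma> b = Some v \<Longrightarrow> operand_value y \<tau> b = Some v' \<Longrightarrow>
      (w = v \<longleftrightarrow> w' = v') \<and> (w = - v \<longleftrightarrow> w' = - v')"
  shows "similar x (\<sigma>(k \<mapsto> w)) y (\<tau>(k \<mapsto> w'))"
proof -
  have old: "(u = w \<and> u' = w') \<or> (operand_value x \<sigma> a = Some u \<and> operand_value y \<tau> a = Some u')"
    if "operand_value x (\<sigma>(k \<mapsto> w)) a = Some u" "operand_value y (\<tau>(k \<mapsto> w')) a = Some u'"
    for a u u'
    using that by (cases a) (auto split: if_splits)
  have "(u = 0 \<longleftrightarrow> u' = 0) \<and> (u = v \<longleftrightarrow> u' = v') \<and> (u = - v \<longleftrightarrow> u' = - v')"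
    if "operand_value x (\<sigma>(k \<mapsto> w)) a = Some u" "operand_value x (\<sigma>(k \<mapsto> w)) b = Some v"
      "operand_value y (\<tau>(k \<mapsto> w')) a = Some u'" "operand_value y (\<tau>(k \<mapsto> w')) b = Some v'"
    for a b u v u' v'
    using old[OF that(1,3)] old[OF that(2,4)]
  proof (elim disjE conjE)
    assume "u = w" "u' = w'" "v = w" "v' = w'"
    then show ?thesis using zero by simp
  next
    assume "u = w" "u' = w'" "operand_value x \<sigma> b = Some v" "operand_value y \<tau> b = Some v'"
    then show ?thesis using zero new[of b v v'] by simp
  next
    assume a: "operand_value x \<sigma> a = Some u" "operand_value y \<tau> a = Some u'" "v = w" "v' = w'"
    have "u = - w \<longleftrightarrow> w = - u" "u' = - w' \<longleftrightarrow> w' = - u'" by auto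
    then show ?thesis using a new[of a u u'] similarD(1)[OF sim a(1) a(1) a(2) a(2)] by auto
  next
    assume "operand_value x \<sigma> a = Some u" "operand_value y \<tau> a = Some u'"
      "operand_value x \<sigma> b = Some v" "operand_value y \<tau> b = Some v'"
    note * = sim this(1,3,2,4)
    show ?thesis using similarD(1)[OF *] similarD(2)[OF *] similarD(3)[OF *] by blast
  qed
  moreover have "dom (\<sigma>(k \<mapsto> w)) = dom (\<tau>(k \<mapsto> w'))"
    using sim unfolding similar_def by simp
  ultimately show ?thesis unfolding similar_def by blast
qed

lemma similar_negate:
  assumes sim: "similar x \<sigma> y \<tau>"
    and u: "operand_value x \<sigma> a = Some u" "operand_value y \<tau> a = Some u'"
  shows "similar x (\<sigma>(k \<mapsto> - u)) y (\<tau>(k \<mapsto> - u'))"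
proof (rule similar_update[OF sim])
  show "- u = 0 \<longleftrightarrow> - u' = 0" using similarD(1)[OF sim u(1) u(1) u(2) u(2)] by simp
next
  fix b v v' assume v: "operand_value x \<sigma> b = Some v" "operand_value y \<tau> b = Some v'"
  have "- u = v \<longleftrightarrow> u = - v" "- u' = v' \<longleftrightarrow> u' = - v'" by auto
  then show "(- u = v \<longleftrightarrow> - u' = v') \<and> (- u = - v \<longleftrightarrow> - u' = - v')"
    using similarD[OF sim u(1) v(1) u(2) v(2)] by auto
qed

lemma similar_arith_op_zero:
  assumes sim: "similar x \<sigma> y \<tau>"
    and "operand_value x \<sigma> a = Some u" "operand_value x \<sigma> b = Some v"
    and "operand_value y \<tau> a = Some u'" "operand_value y \<tau> b = Some v'"
  shows "arith_op f u v = 0 \<longleftrightarrow> arith_op f u' v' = 0"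
proof (cases f)
  case Plus
  then show ?thesis using similarD(3)[OF assms] by (simp add: eq_neg_iff_add_eq_0)
next
  case Minus
  then show ?thesis using similarD(2)[OF assms] by simp
next
  case Times
  then show ?thesis
    using similarD(1)[OF sim assms(2) assms(2) assms(4) assms(4)]
      similarD(1)[OF sim assms(3) assms(3) assms(5) assms(5)] by simp
qed

lemma finite_operand_values:
  assumes "finite (dom \<sigma>)"
  shows "finite {v. \<exists>b. operand_value x \<sigma> b = Some v}"
proof -
  have "{v. \<exists>b. operand_value x \<sigma> b = Some v} \<subseteq> range (\<lambda>i. x $ i) \<union> ran \<sigma>"
  proof clarify
    fix v b assume "operand_value x \<sigma> b = Some v" "v \<notin> ran \<sigma>"
    then show "v \<in> range (\<lambda>i. x $ i)" by (cases b) (auto intro: ranI)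
  qed
  then show ?thesis using finite_ran[OF assms] finite_subset by fastforce
qed

text \<open>Each forbidden value excludes one rounding error, and a disc is infinite.\<close>

lemma generic_rounding_error:
  fixes w w' :: complex and S S' :: "complex set"
  assumes "finite S" "finite S'" "w \<noteq> 0" "w' \<noteq> 0" "0 < e"
  obtains d where "cmod d \<le> e" "w * (1 + d) \<notin> S" "w' * (1 + d) \<notin> S'"
proof -
  let ?B = "(\<lambda>s. s / w - 1) ` S \<union> (\<lambda>s. s / w' - 1) ` S'"
  have "infinite (cball (0::complex) e)"
    using assms(5) uncountable_cball countable_finite by blast
  moreover have "finite ?B" using assms by simp
  ultimately obtain d where d: "d \<in> cball 0 e" "d \<notin> ?B"
    by (meson finite_subset subsetI)
  have "w * (1 + d) \<notin> S"
  proof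
    assume "w * (1 + d) \<in> S"
    moreover have "d = w * (1 + d) / w - 1" using assms by simp
    ultimately show False using d(2) by blast
  qed
  moreover have "w' * (1 + d) \<notin> S'"
  proof
    assume "w' * (1 + d) \<in> S'"
    moreover have "d = w' * (1 + d) / w' - 1" using assms by simp
    ultimately show False using d(2) by blast
  qed
  ultimately show ?thesis using that d(1) by auto
qed

text \<open>Similarity of the operands makes the exact result of the node vanish in both runs or in neither.
  A vanishing result stays zero whatever the error is; a nonzero one can be rounded away from all
  values met so far and from their negatives, in both runs at once.\<close>

lemma similar_compute:
  assumes sim: "similar x \<sigma> y \<tau>" and fin: "finite (dom \<sigma>)"
    and u: "operand_value x \<sigma> a = Some u" "operand_value x \<sigma> b = Some v"
      "operand_value y \<tau> a = Some u'" "operand_value y \<tau> b = Some v'"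
    and e: "0 < e"
  obtains d where "cmod d \<le> e"
    "similar x (\<sigma>(k \<mapsto> arith_op f u v * (1 + d))) y (\<tau>(k \<mapsto> arith_op f u' v' * (1 + d)))"
proof (cases "arith_op f u v = 0")
  case True
  then have True': "arith_op f u' v' = 0" using similar_arith_op_zero[OF sim u] by blast
  have "similar x (\<sigma>(k \<mapsto> 0)) y (\<tau>(k \<mapsto> 0))"
  proof (rule similar_update[OF sim])
    fix b w w' assume "operand_value x \<sigma> b = Some w" "operand_value y \<tau> b = Some w'"
    then show "(0 = w \<longleftrightarrow> 0 = w') \<and> (0 = - w \<longleftrightarrow> 0 = - w')"
      using similarD(1)[OF sim, of b w b w w' w'] by auto
  qed simp
  then show ?thesis using that[of 0] True True' e by simp
next
  case False
  then have False': "arith_op f u' v' \<noteq> 0" using similar_arith_op_zero[OF sim u] by blast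
  define S where "S = {v. \<exists>b. operand_value x \<sigma> b = Some v}"
  define S' where "S' = {v. \<exists>b. operand_value y \<tau> b = Some v}"
  have "finite (dom \<tau>)" using sim fin unfolding similar_def by simp
  then have "finite (insert 0 (S \<union> uminus ` S))" "finite (insert 0 (S' \<union> uminus ` S'))"
    using fin unfolding S_def S'_def by (simp_all add: finite_operand_values)
  then obtain d where d: "cmod d \<le> e" "arith_op f u v * (1 + d) \<notin> insert 0 (S \<union> uminus ` S)"
      "arith_op f u' v' * (1 + d) \<notin> insert 0 (S' \<union> uminus ` S')"
    using generic_rounding_error[OF _ _ False False' e] by metis
  have "similar x (\<sigma>(k \<mapsto> arith_op f u v * (1 + d))) y (\<tau>(k \<mapsto> arith_op f u' v' * (1 + d)))"
  proof (rule similar_update[OF sim])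
    show "(arith_op f u v * (1 + d) = 0) = (arith_op f u' v' * (1 + d) = 0)"
      using d(2,3) by simp
  next
    fix b w w' assume w: "operand_value x \<sigma> b = Some w" "operand_value y \<tau> b = Some w'"
    then have "w \<in> S" "w' \<in> S'" unfolding S_def S'_def by blast+
    then show "(arith_op f u v * (1 + d) = w \<longleftrightarrow> arith_op f u' v' * (1 + d) = w') \<and>
        (arith_op f u v * (1 + d) = - w \<longleftrightarrow> arith_op f u' v' * (1 + d) = - w')"
      using d(2,3) by auto
  qed
  then show ?thesis using that d(1) by blast
qed

text \<open>The errors of nodes that cannot be reached are never read.  This is what makes it possible to
  fix the error of a node after those of its successors.\<close>

lemma returns_rounding_local:
  assumes "returns A x \<delta> k \<sigma> y"
    and "\<And>m. (k, m) \<in> (edges A)\<^sup>* \<Longrightarrow> \<delta> m = \<delta>' m"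
  shows "returns A x \<delta>' k \<sigma> y"
  using assms
proof (induction rule: returns.induct)
  case (compute k f a b s \<sigma> u v y)
  have "(k, s) \<in> edges A" using compute.hyps(1,2) unfolding edges_def by simp
  then have "returns A x \<delta>' s (\<sigma>(k \<mapsto> arith_op f u v * (1 + \<delta> k))) y"
    using compute.IH compute.prems by (meson converse_rtrancl_into_rtrancl)
  then show ?case using compute.hyps compute.prems[of k] by (auto intro: returns.compute)
next
  case (negate k a s \<sigma> u y)
  have "(k, s) \<in> edges A" using negate.hyps(1,2) unfolding edges_def by simp
  then have "returns A x \<delta>' s (\<sigma>(k \<mapsto> - u)) y"
    using negate.IH negate.prems by (meson converse_rtrancl_into_rtrancl)
  then show ?case using negate.hyps by (auto intro: returns.negate)
next
  case (branch k a b s t \<sigma> u v y)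
  have "(k, if u = v then s else t) \<in> edges A" using branch.hyps(1,2) unfolding edges_def by simp
  then have "returns A x \<delta>' (if u = v then s else t) \<sigma> y"
    using branch.IH branch.prems by (meson converse_rtrancl_into_rtrancl)
  then show ?case using branch.hyps by (auto intro: returns.branch)
next
  case (out k a \<sigma> y)
  then show ?case by (auto intro: returns.out)
qed

text \<open>The errors are chosen by well-founded induction along the acyclic graph, backwards from the
  outputs: the error of a node comes from \<open>similar_compute\<close>, and it does not affect the
  continuation, from which the node is unreachable.\<close>

lemma similar_runs:
  assumes dag: "dag A" and e: "0 < e"
    and sim: "similar x \<sigma> y \<tau>" and fin: "finite (dom \<sigma>)"
  shows "\<exists>\<delta>. (\<forall>m. cmod (\<delta> m) \<le> e) \<and>
      (\<forall>r. returns A x \<delta> k \<sigma> r \<longrightarrow> (\<exists>r'. returns A y \<delta> k \<tau> r' \<and> (r = 0 \<longleftrightarrow> r' = 0)))"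
proof -
  have acyc: "acyclic (edges A)" using dag unfolding dag_def by blast
  have "finite (edges A)"
    using dag finite_subset[of "edges A" "{..<length A} \<times> {..<length A}"] unfolding dag_def by simp
  then have wf: "wf ((edges A)\<inverse>)" using acyc by (rule finite_acyclic_wf_converse)
  from wf sim fin show ?thesis
  proof (induction k arbitrary: \<sigma> \<tau> rule: wf_induct_rule)
    case (less k)
    note sim = less.prems(1) and fin = less.prems(2)
    have step: "\<exists>\<delta>. (\<forall>m. cmod (\<delta> m) \<le> e) \<and>
        (\<forall>r. returns A x \<delta> s \<sigma>' r \<longrightarrow> (\<exists>r'. returns A y \<delta> s \<tau>' r' \<and> (r = 0 \<longleftrightarrow> r' = 0)))"
      if "k < length A" "s \<in> successors (A ! k)" "similar x \<sigma>' y \<tau>'" "finite (dom \<sigma>')" for s \<sigma>' \<tau>'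
      using less.IH[of s \<sigma>' \<tau>'] that unfolding edges_def by simp
    show ?case
    proof (cases "\<exists>\<delta> r. returns A x \<delta> k \<sigma> r")
      case False
      then show ?thesis using e by (intro exI[of _ "\<lambda>_. 0"]) auto
    next
      case True
      then obtain \<delta>0 r0 where r0: "returns A x \<delta>0 k \<sigma> r0" by blast
      then show ?thesis
      proof (cases rule: returns.cases)
        case (compute f a b s u v)
        obtain u' v' where u': "operand_value y \<tau> a = Some u'" "operand_value y \<tau> b = Some v'"
          using similar_defined[OF sim compute(3)] similar_defined[OF sim compute(4)] by metis
        obtain d where d: "cmod d \<le> e"
          "similar x (\<sigma>(k \<mapsto> arith_op f u v * (1 + d))) y (\<tau>(k \<mapsto> arith_op f u' v' * (1 + d)))"
          using similar_compute[OF sim fin compute(3,4) u' e] by blast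
        obtain \<delta> where \<delta>: "\<And>m. cmod (\<delta> m) \<le> e" "\<And>r.
           returns A x \<delta> s (\<sigma>(k \<mapsto> arith_op f u v * (1 + d))) r \<Longrightarrow>
           \<exists>r'. returns A y \<delta> s (\<tau>(k \<mapsto> arith_op f u' v' * (1 + d))) r' \<and> (r = 0 \<longleftrightarrow> r' = 0)"
          using step[OF compute(1) _ d(2), of s] compute(2) fin by auto
        have ks: "(k, s) \<in> edges A" using compute(1,2) unfolding edges_def by simp
        have away: "\<delta> m = (\<delta>(k := d)) m" if "(s, m) \<in> (edges A)\<^sup>*" for m
          using that ks acyc unfolding acyclic_def
          by (metis fun_upd_other rtrancl_into_trancl2)
        show ?thesis
        proof (intro exI[of _ "\<delta>(k := d)"] conjI allI impI)
          show "cmod ((\<delta>(k := d)) m) \<le> e" for m using d(1) \<delta>(1) by simp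
        next
          fix r assume "returns A x (\<delta>(k := d)) k \<sigma> r"
          then have "returns A x (\<delta>(k := d)) s (\<sigma>(k \<mapsto> arith_op f u v * (1 + d))) r"
            by (cases rule: returns.cases) (use compute in \<open>auto simp del: fun_upd_apply simp: fun_upd_same\<close>)
          then have "returns A x \<delta> s (\<sigma>(k \<mapsto> arith_op f u v * (1 + d))) r"
            by (rule returns_rounding_local) (simp add: away[symmetric] del: fun_upd_apply)
          then obtain r' where r': "returns A y \<delta> s (\<tau>(k \<mapsto> arith_op f u' v' * (1 + d))) r'"
              "r = 0 \<longleftrightarrow> r' = 0"
            using \<delta>(2) by blast
          have "returns A y (\<delta>(k := d)) s (\<tau>(k \<mapsto> arith_op f u' v' * (1 + d))) r'"
            by (rule returns_rounding_local[OF r'(1)]) (rule away)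
          then have "returns A y (\<delta>(k := d)) k \<tau> r'"
            by (intro returns.compute[OF compute(1,2) u']) simp
          then show "\<exists>r'. returns A y (\<delta>(k := d)) k \<tau> r' \<and> (r = 0 \<longleftrightarrow> r' = 0)"
            using r'(2) by blast
        qed
      next
        case (negate a s u)
        obtain u' where u': "operand_value y \<tau> a = Some u'"
          using similar_defined[OF sim negate(3)] by metis
        obtain \<delta> where \<delta>: "\<And>m. cmod (\<delta> m) \<le> e" "\<And>r. returns A x \<delta> s (\<sigma>(k \<mapsto> - u)) r \<Longrightarrow>
           \<exists>r'. returns A y \<delta> s (\<tau>(k \<mapsto> - u')) r' \<and> (r = 0 \<longleftrightarrow> r' = 0)"
          using step[OF negate(1) _ similar_negate[OF sim negate(3) u', of k], of s] negate(2) fin by auto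
        have "\<exists>r'. returns A y \<delta> k \<tau> r' \<and> (r = 0 \<longleftrightarrow> r' = 0)" if "returns A x \<delta> k \<sigma> r" for r
        proof -
          have "returns A x \<delta> s (\<sigma>(k \<mapsto> - u)) r"
            using that by (cases rule: returns.cases) (use negate in \<open>auto simp del: fun_upd_apply\<close>)
          then show ?thesis using \<delta>(2) returns.negate[OF negate(1,2) u'] by blast
        qed
        then show ?thesis using \<delta>(1) by blast
      next
        case (branch a b s t u v)
        obtain u' v' where u': "operand_value y \<tau> a = Some u'" "operand_value y \<tau> b = Some v'"
          using similar_defined[OF sim branch(3)] similar_defined[OF sim branch(4)] by metis
        have eq: "u = v \<longleftrightarrow> u' = v'" using similarD(2)[OF sim branch(3,4) u'] .
        have "(if u = v then s else t) \<in> successors (A ! k)" unfolding branch(2) by simp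
        then obtain \<delta> where \<delta>: "\<And>m. cmod (\<delta> m) \<le> e"
          "\<And>r. returns A x \<delta> (if u = v then s else t) \<sigma> r \<Longrightarrow>
           \<exists>r'. returns A y \<delta> (if u = v then s else t) \<tau> r' \<and> (r = 0 \<longleftrightarrow> r' = 0)"
          using step[OF branch(1) _ sim fin] by blast
        have "\<exists>r'. returns A y \<delta> k \<tau> r' \<and> (r = 0 \<longleftrightarrow> r' = 0)" if "returns A x \<delta> k \<sigma> r" for r
        proof -
          have "returns A x \<delta> (if u = v then s else t) \<sigma> r"
            using that by (cases rule: returns.cases) (use branch in auto)
          then show ?thesis using \<delta>(2) returns.branch[OF branch(1,2) u'] eq by metis
        qed
        then show ?thesis using \<delta>(1) by blast
      next
        case (out a)
        obtain r' where r': "operand_value y \<tau> a = Some r'"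
          using similar_defined[OF sim out(3)] by metis
        have "returns A y (\<lambda>_. 0) k \<tau> r'" using returns.out[OF out(1,2) r'] .
        moreover have "r = r0" if "returns A x (\<lambda>_. 0) k \<sigma> r" for r
          using that by (cases rule: returns.cases) (use out in auto)
        moreover have "r0 = 0 \<longleftrightarrow> r' = 0" using similarD(1)[OF sim out(3,3) r' r'] .
        ultimately show ?thesis using e by (intro exI[of _ "\<lambda>_. 0"]) auto
      qed
    qed
  qed
qed

lemma p_comp_eq:
  assumes "returns A x \<delta> 0 Map.empty r"
  shows "p_comp A x \<delta> = r"
  unfolding p_comp_def using assms returns_unique by blast

definition allowable_forms :: "(complex ^ 'n::finite \<Rightarrow> complex) set" where
  "allowable_forms = {\<lambda>x. x $ i | i. True} \<union> {\<lambda>x. x $ i + x $ j | i j. i \<noteq> j}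
     \<union> {\<lambda>x. x $ i - x $ j | i j. i \<noteq> j}"

lemma allowable_hyperplanes_eq: "allowable_hyperplanes = (\<lambda>l. {x. l x = 0}) ` allowable_forms"
  unfolding allowable_hyperplanes_def allowable_forms_def hyp_Z_def hyp_S_def hyp_D_def image_Un
  by (intro arg_cong2[where f = "(\<union>)"]) (fastforce simp: image_def)+

lemma finite_allowable_forms: "finite (allowable_forms :: (complex ^ 'n::finite \<Rightarrow> complex) set)"
proof -
  have "allowable_forms \<subseteq> range (\<lambda>i x. x $ i :: complex) \<union>
      (\<lambda>(i, j) x. x $ i + x $ j) ` (UNIV :: ('n \<times> 'n) set) \<union>
      (\<lambda>(i, j) x. x $ i - x $ j) ` (UNIV :: ('n \<times> 'n) set)"
    unfolding allowable_forms_def by auto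
  then show ?thesis by (rule finite_subset) simp
qed

text \<open>At a zero of \<open>f\<close> a relative error bound leaves no room, so the rounded output is exactly zero
  for the generic errors of \<open>similar_runs\<close>; it is then zero for the other input too, where a
  relative error below one admits this only if \<open>f\<close> vanishes.\<close>

lemma accurate_zero_transfer:
  fixes f :: "complex ^ 'n::finite \<Rightarrow> complex"
  assumes "accurately_evaluable f UNIV"
    and pattern: "\<And>l. l \<in> allowable_forms \<Longrightarrow> l x = 0 \<longleftrightarrow> l y = 0"
    and "f x = 0"
  shows "f y = 0"
proof -
  obtain A where A: "algorithm A" "accurate_on A f UNIV"
    using assms(1) unfolding accurately_evaluable_def algorithm_for_def by blast
  \<comment> \<open>Any relative error bound below \<open>1\<close> separates zero from nonzero values.\<close>
  obtain e :: real where e: "0 < e" "\<And>x \<delta>. \<forall>i<length A. cmod (\<delta> i) \<le> e \<Longrightarrow>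
      cmod (p_comp A x \<delta> - f x) \<le> 1/2 * cmod (f x)"
    using A(2)[unfolded accurate_on_def, rule_format, of "1/2"] by auto
  have Z: "x $ i = 0 \<longleftrightarrow> y $ i = 0" for i
    by (rule pattern[of "\<lambda>x. x $ i"]) (auto simp: allowable_forms_def)
  have S: "x $ i + x $ j = 0 \<longleftrightarrow> y $ i + y $ j = 0" if "i \<noteq> j" for i j
    by (rule pattern[of "\<lambda>x. x $ i + x $ j"]) (use that in \<open>auto simp: allowable_forms_def\<close>)
  have D: "x $ i - x $ j = 0 \<longleftrightarrow> y $ i - y $ j = 0" if "i \<noteq> j" for i j
    by (rule pattern[of "\<lambda>x. x $ i - x $ j"]) (use that in \<open>auto simp: allowable_forms_def\<close>)
  have "similar x Map.empty y Map.empty"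
    unfolding similar_def
  proof (intro conjI allI impI; (simp; fail)?)
    fix a b u v u' v'
    assume "operand_value x Map.empty a = Some u" "operand_value x Map.empty b = Some v"
      "operand_value y Map.empty a = Some u'" "operand_value y Map.empty b = Some v'"
    then obtain i j where *: "u = x $ i" "v = x $ j" "u' = y $ i" "v' = y $ j"
      by (cases a; cases b) auto
    show "u = 0 \<longleftrightarrow> u' = 0" using * Z by simp
    show "u = v \<longleftrightarrow> u' = v'" using * D[of i j] by (cases "i = j") auto
    show "u = - v \<longleftrightarrow> u' = - v'"
      using * S[of i j] Z[of i] by (cases "i = j") (auto simp: eq_neg_iff_add_eq_0)
  qed
  then obtain \<delta> where \<delta>: "\<And>m. cmod (\<delta> m) \<le> e" "\<And>r. returns A x \<delta> 0 Map.empty r \<Longrightarrow>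
      \<exists>r'. returns A y \<delta> 0 Map.empty r' \<and> (r = 0 \<longleftrightarrow> r' = 0)"
    using similar_runs[OF _ e(1), of A x Map.empty y Map.empty 0] A(1)
    unfolding algorithm_def by auto
  have "p_comp A x \<delta> = 0" using e(2)[of \<delta> x] \<delta>(1) assms(3) by simp
  moreover obtain r where r: "returns A x \<delta> 0 Map.empty r"
    using A(1) unfolding algorithm_def by blast
  ultimately have "r = 0" using p_comp_eq by metis
  then have "p_comp A y \<delta> = 0" using \<delta>(2)[OF r] p_comp_eq by metis
  then show ?thesis using e(2)[of \<delta> y] \<delta>(1) by simp
qed

section \<open>Polynomial functions\<close>

text \<open>Complex polynomial functions, as functions rather than formal expressions: only their
  restrictions to lines and their divisibility by linear forms matter here, and both can be
  treated by induction on how a function is built.\<close>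

inductive polyfun :: "(complex ^ 'n::finite \<Rightarrow> complex) \<Rightarrow> bool" where
  const: "polyfun (\<lambda>x. c)"
| coord: "polyfun (\<lambda>x. x $ i)"
| add: "polyfun f \<Longrightarrow> polyfun g \<Longrightarrow> polyfun (\<lambda>x. f x + g x)"
| mult: "polyfun f \<Longrightarrow> polyfun g \<Longrightarrow> polyfun (\<lambda>x. f x * g x)"

lemma polyfun_diff: "polyfun f \<Longrightarrow> polyfun g \<Longrightarrow> polyfun (\<lambda>x. f x - g x)"
  using polyfun.add[of f "\<lambda>x. (-1) * g x"] polyfun.mult[OF polyfun.const[of "-1"], of g] by simp

lemma polyfun_sum: "(\<And>i. i \<in> I \<Longrightarrow> polyfun (F i)) \<Longrightarrow> polyfun (\<lambda>x. \<Sum>i\<in>I. F i x)"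
  by (induction I rule: infinite_finite_induct) (auto intro: polyfun.intros)

lemma polyfun_prod: "(\<And>i. i \<in> I \<Longrightarrow> polyfun (F i)) \<Longrightarrow> polyfun (\<lambda>x. \<Prod>i\<in>I. F i x)"
  by (induction I rule: infinite_finite_induct) (auto intro: polyfun.intros)

lemma polyfun_power: "polyfun f \<Longrightarrow> polyfun (\<lambda>x. f x ^ k)"
  by (induction k) (auto intro: polyfun.intros)

lemma polyfun_eval_mpoly: "polyfun (eval_mpoly p)"
  unfolding eval_mpoly_def[abs_def]
  by (intro polyfun_sum polyfun.mult polyfun.const polyfun_prod polyfun_power polyfun.coord)

lemma polyfun_compose:
  assumes "polyfun f" and "\<And>i. polyfun (\<lambda>x. h x $ i)"
  shows "polyfun (\<lambda>x. f (h x))"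
  using assms by induction (auto intro: polyfun.intros)

lemma polyfun_shift:
  assumes "polyfun f" "polyfun s"
  shows "polyfun (\<lambda>x. f (x + s x *s v))" "polyfun (\<lambda>x. f (a + s x *s v))"
  by (rule polyfun_compose[OF assms(1)];
      simp add: polyfun.add polyfun.mult polyfun.coord polyfun.const assms(2))+

lemma polyfun_on_line:
  assumes "polyfun f"
  obtains q where "\<And>t. f (a + t *s v) = poly q t"
proof -
  from assms have "\<exists>q. \<forall>t. f (a + t *s v) = poly q t"
  proof induction
    case (const c)
    show ?case by (rule exI[of _ "[:c:]"]) simp
  next
    case (coord i)
    show ?case by (rule exI[of _ "[:a $ i, v $ i:]"]) simp
  next
    case (add f g)
    then show ?case by (metis poly_add)
  next
    case (mult f g)
    then show ?case by (metis poly_mult)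
  qed
  then show ?thesis using that by blast
qed

text \<open>Restricting to the line through \<open>a\<close> and \<open>b\<close> reduces the claim to polynomials in one
  variable.\<close>

lemma polyfun_no_zero_divisors:
  assumes "polyfun f" "polyfun g" "f a \<noteq> 0" "g b \<noteq> 0"
  obtains z where "f z \<noteq> 0" "g z \<noteq> 0"
proof -
  obtain q where q: "\<And>t. f (a + t *s (b - a)) = poly q t" using polyfun_on_line[OF assms(1)] by blast
  obtain r where r: "\<And>t. g (a + t *s (b - a)) = poly r t" using polyfun_on_line[OF assms(2)] by blast
  have "q \<noteq> 0" using q[of 0] assms(3) by auto
  moreover have "r \<noteq> 0" using r[of 1] assms(4) by auto
  ultimately have "q * r \<noteq> 0" by simp
  then obtain t where "poly (q * r) t \<noteq> 0" using poly_all_0_iff_0 by blast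
  then have "poly q t \<noteq> 0" "poly r t \<noteq> 0" by auto
  then show ?thesis using that unfolding q[symmetric] r[symmetric] by blast
qed

text \<open>This lemma supplies all generic points and directions below.\<close>

lemma polyfun_common_nonzero:
  assumes "finite S" and "\<And>g. g \<in> S \<Longrightarrow> polyfun g" and "\<And>g. g \<in> S \<Longrightarrow> \<exists>x. g x \<noteq> 0"
  shows "\<exists>z. \<forall>g\<in>S. g z \<noteq> 0"
proof -
  from assms have "\<exists>z. (\<Prod>g\<in>S. g z) \<noteq> 0"
  proof induction
    case (insert g S)
    have "polyfun (\<lambda>x. \<Prod>g\<in>S. g x)" using insert by (intro polyfun_prod) blast
    moreover obtain a where "g a \<noteq> 0" using insert by blast
    moreover obtain b where "(\<Prod>g\<in>S. g b) \<noteq> 0" using insert by blast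
    ultimately obtain z where "g z \<noteq> 0" "(\<Prod>g\<in>S. g z) \<noteq> 0"
      using polyfun_no_zero_divisors[of g "\<lambda>x. \<Prod>g\<in>S. g x"] insert.prems by (metis insertI1)
    then show ?case using insert.hyps by auto
  qed simp
  then show ?thesis using assms(1) by (auto simp: prod_zero_iff)
qed

section \<open>Allowable forms and unions of allowable subspaces\<close>

definition linear_form :: "(complex ^ 'n::finite \<Rightarrow> complex) \<Rightarrow> bool" where
  "linear_form l \<longleftrightarrow> polyfun l \<and> (\<forall>x t v. l (x + t *s v) = l x + t * l v)"

lemma allowable_form_cases:
  assumes "l \<in> allowable_forms"
  obtains i where "l = (\<lambda>x. x $ i)"
    | i j where "i \<noteq> j" "l = (\<lambda>x. x $ i + x $ j)"
    | i j where "i \<noteq> j" "l = (\<lambda>x. x $ i - x $ j)"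
  using assms unfolding allowable_forms_def by blast

lemma linear_form_allowable:
  assumes "l \<in> allowable_forms" shows "linear_form l"
  using assms
proof (cases rule: allowable_form_cases)
  case 1
  then show ?thesis unfolding linear_form_def by (simp add: polyfun.coord)
next
  case 2
  then show ?thesis unfolding linear_form_def
    by (simp add: polyfun.add polyfun.coord algebra_simps)
next
  case 3
  then show ?thesis unfolding linear_form_def
    by (simp add: polyfun_diff polyfun.coord algebra_simps)
qed

lemma allowable_form_nonzero:
  assumes "l \<in> allowable_forms" shows "\<exists>x. l x \<noteq> 0"
  using assms
proof (cases rule: allowable_form_cases)
  case (1 i)
  then show ?thesis by (intro exI[of _ "axis i 1"]) (simp add: axis_def)
next
  case (2 i j)
  then show ?thesis by (intro exI[of _ "axis i 1"]) (simp add: axis_def)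
next
  case (3 i j)
  then show ?thesis by (intro exI[of _ "axis i 1"]) (simp add: axis_def)
qed

text \<open>If \<open>x\<close> is a zero and \<open>y\<close> lies on all allowable hyperplanes through \<open>x\<close>, a generic point of
  the line from \<open>x\<close> to \<open>y\<close> has the same vanishing forms as \<open>x\<close>.  The function therefore vanishes
  on almost all of the line, hence at \<open>y\<close>.\<close>

lemma allowable_if_vanishing_transfers:
  fixes f :: "complex ^ 'n::finite \<Rightarrow> complex"
  assumes f: "polyfun f"
    and transfer: "\<And>x y. (\<And>l. l \<in> allowable_forms \<Longrightarrow> l x = 0 \<longleftrightarrow> l y = 0) \<Longrightarrow> f x = 0 \<Longrightarrow> f y = 0"
  shows "allowable {x. f x = 0}"
proof -
  define C where "C x = {H \<in> allowable_hyperplanes. x \<in> H}" for x :: "complex ^ 'n"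
  have "f y = 0" if x: "f x = 0" and y: "y \<in> \<Inter>(C x)" for x y
  proof (rule ccontr)
    assume "f y \<noteq> 0"
    \<comment> \<open>One coordinate of \<open>w\<close> serves as the parameter of the line from \<open>x\<close> to \<open>y\<close>, so that
      the lemma on common nonzeros applies to the functions along this line.\<close>
    obtain i :: 'n where True by blast
    define S where "S = insert f {l \<in> allowable_forms. l x \<noteq> 0}"
    define h where "h w = x + (w $ i) *s (y - x)" for w :: "complex ^ 'n"
    have h01: "h 0 = x" "h 1 = y" unfolding h_def by (simp_all add: vec_eq_iff)
    have "\<exists>w. \<forall>g\<in>(\<lambda>g w. g (h w)) ` S. g w \<noteq> 0"
    proof (rule polyfun_common_nonzero[of "(\<lambda>g w. g (h w)) ` S"])
      show "finite ((\<lambda>g w. g (h w)) ` S)" unfolding S_def 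
        by (intro finite_imageI finite.insertI finite_subset[OF _ finite_allowable_forms]) blast
    next
      fix g assume "g \<in> (\<lambda>g w. g (h w)) ` S"
      then obtain g' where g': "g = (\<lambda>w. g' (h w))" "g' \<in> S" by blast
      have "polyfun g'" using g' f linear_form_allowable unfolding S_def linear_form_def by auto
      then show "polyfun g" unfolding g'(1) h_def by (intro polyfun_shift polyfun.coord)
      show "\<exists>w. g w \<noteq> 0" 
      proof (cases "g' = f")
        case True
        then show ?thesis unfolding g'(1) using h01(2) \<open>f y \<noteq> 0\<close> by (intro exI[of _ 1]) simp
      next
        case False
        then have "g' x \<noteq> 0" using g'(2) unfolding S_def by blast
        then show ?thesis unfolding g'(1) using h01(1) by (intro exI[of _ 0]) simp
      qed
    qed
    then obtain w where w: "\<And>g. g \<in> S \<Longrightarrow> g (h w) \<noteq> 0" by auto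
    have "l x = 0 \<longleftrightarrow> l (h w) = 0" if l: "l \<in> allowable_forms" for l
    proof (cases "l x = 0")
      case True
      then have "l y = 0" using y l unfolding C_def allowable_hyperplanes_eq by auto
      have "l (h w) = l x + w $ i * l (y - x)" 
        using linear_form_allowable[OF l] unfolding linear_form_def h_def by blast
      moreover have "l y = l x + 1 * l (y - x)"
        using linear_form_allowable[OF l] unfolding linear_form_def
        by (metis add.commute diff_add_cancel vector_smult_lid)
      ultimately show ?thesis using True \<open>l y = 0\<close> by simp
    next
      case False
      then have "l (h w) \<noteq> 0" using w l unfolding S_def by blast
      then show ?thesis using False by blast
    qed
    then have "f (h w) = 0" using transfer x by blast
    then show False using w unfolding S_def by blast
  qed
  moreover have "x \<in> \<Inter>(C x)" for x unfolding C_def by blast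
  ultimately have "{x. f x = 0} = (\<Union>D\<in>C ` {x. f x = 0}. \<Inter>D)" by blast
  moreover have "finite (C ` {x. f x = 0})"
    by (rule finite_subset[of _ "Pow allowable_hyperplanes"])
      (auto simp: C_def allowable_hyperplanes_eq finite_allowable_forms)
  moreover have "\<forall>D\<in>C ` {x. f x = 0}. D \<subseteq> allowable_hyperplanes" unfolding C_def by blast
  ultimately show ?thesis unfolding allowable_def by blast
qed

section \<open>Functions vanishing only on finitely many hyperplanes\<close>

text \<open>Project along \<open>v\<close> onto the hyperplane \<open>l = 0\<close>.  A polynomial function and its composition with
  the projection differ by a multiple of \<open>l\<close>, as the coordinates do; on functions vanishing on
  the hyperplane this composition is zero.\<close>

lemma linear_form_factor:
  assumes f: "polyfun f" and l: "linear_form l" and v: "l v \<noteq> 0"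
    and vanish: "\<And>x. l x = 0 \<Longrightarrow> f x = 0"
  obtains g where "polyfun g" "\<And>x. f x = l x * g x"
proof -
  define \<pi> where "\<pi> x = x + (- (l x / l v)) *s v" for x
  have pl: "polyfun l" using l unfolding linear_form_def by blast
  have p\<pi>: "polyfun (\<lambda>x. - (l x / l v))"
    using polyfun.mult[OF polyfun.const[of "- inverse (l v)"] pl] by (simp add: field_simps)
  from f have "\<exists>g. polyfun g \<and> (\<forall>x. f x - f (\<pi> x) = l x * g x)"
  proof induction
    case (const c)
    show ?case using polyfun.const[of 0] by fastforce
  next
    case (coord i)
    show ?case using polyfun.const[of "v $ i / l v"] unfolding \<pi>_def by fastforce
  next
    case (add f g)
    then obtain f' g' where fg: "polyfun f'" "polyfun g'" "\<And>x. f x - f (\<pi> x) = l x * f' x"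
      "\<And>x. g x - g (\<pi> x) = l x * g' x" by blast
    have "f x + g x - (f (\<pi> x) + g (\<pi> x)) = l x * (f' x + g' x)" for x
      using fg(3)[of x] fg(4)[of x] by (simp only: add_diff_add distrib_left)
    then show ?case using polyfun.add[OF fg(1,2)] by blast
  next
    case (mult f g)
    then obtain f' g' where fg: "polyfun f'" "polyfun g'" "\<And>x. f x - f (\<pi> x) = l x * f' x"
      "\<And>x. g x - g (\<pi> x) = l x * g' x" by blast
    have "polyfun (\<lambda>x. g (\<pi> x))" unfolding \<pi>_def using mult.hyps(2) p\<pi> by (rule polyfun_shift)
    then have "polyfun (\<lambda>x. f x * g' x + f' x * g (\<pi> x))"
      using fg mult.hyps by (intro polyfun.intros)
    moreover have "f x * g x - f (\<pi> x) * g (\<pi> x) = l x * (f x * g' x + f' x * g (\<pi> x))" for x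
    proof -
      have "f x * g x - f (\<pi> x) * g (\<pi> x) = f x * (g x - g (\<pi> x)) + (f x - f (\<pi> x)) * g (\<pi> x)"
        by (simp add: algebra_simps)
      then show ?thesis unfolding fg(3,4) by (simp add: algebra_simps)
    qed
    ultimately show ?case by blast
  qed
  then obtain g where g: "polyfun g" "\<And>x. f x - f (\<pi> x) = l x * g x" by blast
  have "l (\<pi> x) = l x + - (l x / l v) * l v" for x
    using l unfolding linear_form_def \<pi>_def by blast
  then have "l (\<pi> x) = 0" for x using v by simp
  then have "f (\<pi> x) = 0" for x using vanish by blast
  then show ?thesis using that g by (metis diff_zero)
qed

text \<open>Along a direction \<open>v\<close> transversal to all hyperplanes, a line meets each of them in one point.
  For a generic line none of these points is a zero of \<open>f\<close>, so \<open>f\<close> has no zero on the line and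
  is constant there.  Thus \<open>f\<close> is invariant under all transversal translations, and any two
  points reach a common third one by such translations.\<close>

lemma constant_if_no_hyperplane_of_zeros:
  assumes L: "finite L" "\<And>l. l \<in> L \<Longrightarrow> linear_form l" "\<And>l. l \<in> L \<Longrightarrow> \<exists>x. l x \<noteq> 0"
    and f: "polyfun f" and zeros: "\<And>x. f x = 0 \<Longrightarrow> \<exists>l\<in>L. l x = 0"
    and nonzero: "\<And>l. l \<in> L \<Longrightarrow> \<exists>x. l x = 0 \<and> f x \<noteq> 0"
  shows "f x = f y"
proof -
  have pl: "polyfun l" and ll: "l (x + t *s v) = l x + t * l v" if "l \<in> L" for l x t v
    using L(2)[OF that] unfolding linear_form_def by blast+
  have invariant: "f (a + v) = f a" if v: "\<And>l. l \<in> L \<Longrightarrow> l v \<noteq> 0" for a v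
  proof (rule ccontr)
    assume "f (a + v) \<noteq> f a"
    define S where "S = insert (\<lambda>x. f (x + v) - f x) ((\<lambda>l x. f (x + (- (l x / l v)) *s v)) ` L)"
    have "\<exists>z. \<forall>g\<in>S. g z \<noteq> 0"
    proof (rule polyfun_common_nonzero[of S])
      show "finite S" unfolding S_def using L(1) by simp
    next
      fix g assume "g \<in> S"
      then consider "g = (\<lambda>x. f (x + v) - f x)"
        | l where "l \<in> L" "g = (\<lambda>x. f (x + (- (l x / l v)) *s v))"
        unfolding S_def by blast
      then show "polyfun g"
      proof cases
        case 1
        then show ?thesis
          using polyfun_diff[OF polyfun_shift(1)[OF f polyfun.const[of 1], of v] f] by simp
      next
        case 2
        have "polyfun (\<lambda>x. - (l x / l v))"
          using polyfun.mult[OF polyfun.const[of "- inverse (l v)"] pl[OF 2(1)]]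
          by (simp add: field_simps)
        then show ?thesis unfolding 2(2) using polyfun_shift(1)[OF f] by blast
      qed
    next
      fix g assume "g \<in> S"
      then consider "g = (\<lambda>x. f (x + v) - f x)"
        | l where "l \<in> L" "g = (\<lambda>x. f (x + (- (l x / l v)) *s v))"
        unfolding S_def by blast
      then show "\<exists>x. g x \<noteq> 0"
      proof cases
        case 1
        then show ?thesis using \<open>f (a + v) \<noteq> f a\<close> by auto
      next
        case 2
        then obtain x where "l x = 0" "f x \<noteq> 0" using nonzero by blast
        then show ?thesis unfolding 2(2) by (intro exI[of _ x]) simp
      qed
    qed
    then obtain z where z: "\<And>g. g \<in> S \<Longrightarrow> g z \<noteq> 0" by blast
    obtain q where q: "\<And>t. f (z + t *s v) = poly q t" using polyfun_on_line[OF f] by blast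
    have "poly q 1 \<noteq> poly q 0" using z[of "\<lambda>x. f (x + v) - f x"] q[of 1] q[of 0] unfolding S_def by simp
    then have "\<not> constant (poly q)" unfolding constant_def by metis
    \<comment> \<open>The zero found on the line must be one of its intersections with the hyperplanes, which
      the choice of \<open>z\<close> has excluded.\<close>
    then obtain t where "poly q t = 0" using fundamental_theorem_of_algebra by blast
    then have t: "f (z + t *s v) = 0" using q by simp
    then obtain l where l: "l \<in> L" "l (z + t *s v) = 0" using zeros by blast
    then have "l z + t * l v = 0" using ll by simp
    then have "t = - (l z / l v)" using v[OF l(1)] by (simp add: field_simps eq_neg_iff_add_eq_0)
    then show False using t z[of "\<lambda>x. f (x + (- (l x / l v)) *s v)"] l(1) unfolding S_def by auto
  qed
  have "\<exists>v. \<forall>g\<in>L \<union> (\<lambda>l v. l (x - y + v)) ` L. g v \<noteq> 0"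
  proof (rule polyfun_common_nonzero[of "L \<union> (\<lambda>l v. l (x - y + v)) ` L"])
    show "finite (L \<union> (\<lambda>l v. l (x - y + v)) ` L)" using L(1) by simp
  next
    fix g assume g: "g \<in> L \<union> (\<lambda>l v. l (x - y + v)) ` L"
    have "polyfun (\<lambda>v. l (x - y + v))" if "l \<in> L" for l
      using polyfun_shift(1)[OF pl[OF that] polyfun.const[of 1], of "x - y"]
      by (simp add: add.commute)
    then show "polyfun g" using g pl by blast
    have "\<exists>v. l (x - y + v) \<noteq> 0" if "l \<in> L" for l
      using L(3)[OF that] by (metis add_diff_cancel_left' diff_add_cancel add.commute)
    then show "\<exists>x. g x \<noteq> 0" using g L(3) by auto
  qed
  then obtain v where *: "\<forall>g\<in>L \<union> (\<lambda>l v. l (x - y + v)) ` L. g v \<noteq> 0" ..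
  have v: "l v \<noteq> 0" "l (x - y + v) \<noteq> 0" if "l \<in> L" for l
    using bspec[OF * UnI1[OF that]] bspec[OF * UnI2[OF imageI[OF that]]] .
  have "f x = f (x + v)" using invariant[of v x] v(1) by simp
  also have "\<dots> = f (y + (x - y + v))" by simp
  also have "\<dots> = f y" using invariant[of "x - y + v" y] v(2) by blast
  finally show ?thesis .
qed

text \<open>Induction on a bound for the degree along one fixed transversal direction: dividing by a form
  lowers it, since the form is nonconstant in that direction.\<close>

lemma factorization_with_degree:
  assumes L: "finite L" "\<And>l. l \<in> L \<Longrightarrow> linear_form l" and v: "\<And>l. l \<in> L \<Longrightarrow> l v \<noteq> 0"
  shows "polyfun f \<Longrightarrow> \<exists>x. f x \<noteq> 0 \<Longrightarrow> (\<And>x. f x = 0 \<Longrightarrow> \<exists>l\<in>L. l x = 0) \<Longrightarrow>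
     (\<And>a. \<exists>q. degree q \<le> d \<and> (\<forall>t. f (a + t *s v) = poly q t)) \<Longrightarrow>
     \<exists>c ls. set ls \<subseteq> L \<and> (\<forall>x. f x = c * prod_list (map (\<lambda>l. l x) ls))"
proof (induction d arbitrary: f rule: less_induct)
  case (less d)
  show ?case
  proof (cases "\<exists>l\<in>L. \<forall>x. l x = 0 \<longrightarrow> f x = 0")
    case True
    then obtain l where l: "l \<in> L" "\<And>x. l x = 0 \<Longrightarrow> f x = 0" by blast
    obtain g where g: "polyfun g" "\<And>x. f x = l x * g x"
      using linear_form_factor[OF less.prems(1) L(2)[OF l(1)] v[OF l(1)] l(2)] by blast
    obtain z where z: "g z \<noteq> 0" using less.prems(2) g(2) by auto
    have deg: "\<exists>r. (r = 0 \<or> Suc (degree r) \<le> d) \<and> (\<forall>t. g (a + t *s v) = poly r t)" for a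
    proof -
      obtain q where q: "degree q \<le> d" "\<And>t. f (a + t *s v) = poly q t" using less.prems(4) by blast
      obtain r where r: "\<And>t. g (a + t *s v) = poly r t" using polyfun_on_line[OF g(1)] by blast
      have "poly q t = poly ([:l a, l v:] * r) t" for t
      proof -
        have "l (a + t *s v) = l a + t * l v" using L(2)[OF l(1)] unfolding linear_form_def by blast
        then show ?thesis using q(2)[of t] r[of t] g(2)[of "a + t *s v"]
          by (simp add: algebra_simps)
      qed
      then have "q = [:l a, l v:] * r" using poly_eq_poly_eq_iff by blast
      then have "degree q = Suc (degree r)" if "r \<noteq> 0"
        using that v[OF l(1)] degree_mult_eq[of "[:l a, l v:]" r] by (simp del: mult_pCons_left)
      then show ?thesis using q(1) r by metis
    qed
    obtain r where "r = 0 \<or> Suc (degree r) \<le> d" "\<And>t. g (z + t *s v) = poly r t" using deg by blast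
    then have "0 < d" using z by (metis add_cancel_right_right not_less_eq_eq le0 poly_0 vector_smult_lzero zero_less_iff_neq_zero)
    have "\<exists>r. degree r \<le> d - 1 \<and> (\<forall>t. g (a + t *s v) = poly r t)" for a
      using deg[of a] by force
    moreover have "\<exists>l\<in>L. l x = 0" if "g x = 0" for x using that less.prems(3) g(2) by simp
    ultimately obtain c ls where "set ls \<subseteq> L" "\<And>x. g x = c * prod_list (map (\<lambda>l. l x) ls)"
      using less.IH[of "d - 1" g] \<open>0 < d\<close> g(1) z by (metis diff_less zero_less_one)
    then show ?thesis using l(1) g(2) by (intro exI[of _ c] exI[of _ "l # ls"]) simp
  next
    case False
    have "f x = f 0" for x
      by (rule constant_if_no_hyperplane_of_zeros[OF L(1,2) _ less.prems(1,3)]) (use v False in auto)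
    then show ?thesis by (intro exI[of _ "f 0"] exI[of _ "[]"]) simp
  qed
qed

lemma polyfun_degree_bound:
  assumes "polyfun f"
  shows "\<exists>d. \<forall>a. \<exists>q. degree q \<le> d \<and> (\<forall>t. f (a + t *s v) = poly q t)"
  using assms
proof induction
  case (const c)
  show ?case by (intro exI[of _ 0] allI exI[of _ "[:c:]"]) simp
next
  case (coord i)
  have "degree [:a $ i, v $ i:] \<le> 1 \<and> (\<forall>t. (a + t *s v) $ i = poly [:a $ i, v $ i:] t)" for a
    by simp
  then show ?case by blast
next
  case (add f g)
  then obtain d d' where *: "\<And>a. \<exists>q. degree q \<le> d \<and> (\<forall>t. f (a + t *s v) = poly q t)"
    "\<And>a. \<exists>q. degree q \<le> d' \<and> (\<forall>t. g (a + t *s v) = poly q t)" by blast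
  have "\<exists>q. degree q \<le> max d d' \<and> (\<forall>t. f (a + t *s v) + g (a + t *s v) = poly q t)" for a
  proof -
    obtain q r where "degree q \<le> d" "degree r \<le> d'" "\<And>t. f (a + t *s v) = poly q t"
      "\<And>t. g (a + t *s v) = poly r t" using *[of a] by blast
    then show ?thesis by (intro exI[of _ "q + r"]) (auto intro: degree_add_le)
  qed
  then show ?case by blast
next
  case (mult f g)
  then obtain d d' where *: "\<And>a. \<exists>q. degree q \<le> d \<and> (\<forall>t. f (a + t *s v) = poly q t)"
    "\<And>a. \<exists>q. degree q \<le> d' \<and> (\<forall>t. g (a + t *s v) = poly q t)" by blast
  have "\<exists>q. degree q \<le> d + d' \<and> (\<forall>t. f (a + t *s v) * g (a + t *s v) = poly q t)" for a
  proof -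
    obtain q r where "degree q \<le> d" "degree r \<le> d'" "\<And>t. f (a + t *s v) = poly q t"
      "\<And>t. g (a + t *s v) = poly r t" using *[of a] by blast
    then show ?thesis 
      by (intro exI[of _ "q * r"]) (auto intro: order.trans[OF degree_mult_le])
  qed
  then show ?case by blast
qed

lemma factorization:
  assumes L: "finite L" "\<And>l. l \<in> L \<Longrightarrow> linear_form l" "\<And>l. l \<in> L \<Longrightarrow> \<exists>x. l x \<noteq> 0"
    and f: "polyfun f" "\<exists>x. f x \<noteq> 0" "\<And>x. f x = 0 \<Longrightarrow> \<exists>l\<in>L. l x = 0"
  obtains c ls where "set ls \<subseteq> L" "\<And>x. f x = c * prod_list (map (\<lambda>l. l x) ls)"
proof -
  obtain v where v: "\<And>l. l \<in> L \<Longrightarrow> l v \<noteq> 0"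
    using polyfun_common_nonzero[OF L(1) _ L(3)] L(2) unfolding linear_form_def by blast
  obtain d where "\<And>a. \<exists>q. degree q \<le> d \<and> (\<forall>t. f (a + t *s v) = poly q t)"
    using polyfun_degree_bound[OF f(1)] by blast
  then have "\<exists>c ls. set ls \<subseteq> L \<and> (\<forall>x. f x = c * prod_list (map (\<lambda>l. l x) ls))"
    by (intro factorization_with_degree[OF L(1,2) v f]) blast+
  then show ?thesis using that by blast
qed

text \<open>A function that is not identically zero rules out the empty intersection, which is the whole
  space.\<close>

lemma allowable_zeros_on_hyperplanes:
  assumes "allowable {x. f x = 0}" "\<exists>x. f x \<noteq> 0" "f x = 0"
  shows "\<exists>l\<in>allowable_forms. l x = 0"
proof -
  obtain F where F: "\<And>C. C \<in> F \<Longrightarrow> C \<subseteq> allowable_hyperplanes" "{x. f x = 0} = (\<Union>C\<in>F. \<Inter>C)"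
    using assms(1) unfolding allowable_def by blast
  then obtain C where C: "C \<in> F" "x \<in> \<Inter>C" using assms(3) by blast
  have "C \<noteq> {}" using C(1) F(2) assms(2) by auto
  then obtain H where H: "H \<in> C" by blast
  then have "H \<in> (\<lambda>l. {x. l x = 0}) ` allowable_forms" using F(1)[OF C(1)] allowable_hyperplanes_eq by blast
  then show ?thesis using H C(2) by blast
qed

section \<open>Integrality of the constant factor\<close>

text \<open>Only the coefficients carry the integrality of \<open>p\<close> over to its factorization, which is
  obtained over the complex numbers.  A curve of powers of one parameter keeps them visible while
  leaving a single variable.\<close>

lemma eval_mpoly_monomial_curve:
  fixes p :: "'n::finite int_mpoly"
  obtains P where "\<And>k. coeff P k \<in> \<int>" "\<And>t. eval_mpoly p (\<chi> i. t ^ e i) = poly P t"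
proof
  let ?P = "\<Sum>m\<in>Poly_Mapping.keys p. monom (of_int (Poly_Mapping.lookup p m) :: complex)
    (\<Sum>i\<in>UNIV. e i * Poly_Mapping.lookup m i)"
  show "coeff ?P k \<in> \<int>" for k
    by (simp add: coeff_sum Ints_sum)
  show "eval_mpoly p (\<chi> i. t ^ e i) = poly ?P t" for t
    unfolding eval_mpoly_def by (simp add: poly_sum poly_monom power_sum power_mult)
qed

text \<open>Distinct exponents keep the two terms of a form from cancelling or merging.\<close>

lemma allowable_form_monomial_curve:
  assumes "inj e" "l \<in> allowable_forms"
  shows "\<exists>Q. lead_coeff Q \<in> {1, -1} \<and> (\<forall>t. l (\<chi> i. t ^ e i) = poly Q t)"
proof -
  have lead: "lead_coeff (monom 1 a + monom s b :: complex poly) \<in> {1, s}" if "a \<noteq> b" "s \<noteq> 0" for a b s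
  proof (cases "a < b")
    case True
    then have "lead_coeff (monom 1 a + monom s b) = lead_coeff (monom s b)"
      using that(2) by (intro lead_coeff_add_le) (simp add: degree_monom_eq)
    then show ?thesis by (simp only: lead_coeff_monom insert_iff simp_thms)
  next
    case False
    then have "lead_coeff (monom s b + monom 1 a) = lead_coeff (monom 1 a :: complex poly)"
      using that by (intro lead_coeff_add_le) (simp add: degree_monom_eq)
    then show ?thesis by (simp only: lead_coeff_monom insert_iff simp_thms add.commute[of "monom 1 a"])
  qed
  consider i where "l = (\<lambda>x. x $ i)"
    | i j s where "i \<noteq> j" "s \<in> {1, -1}" "l = (\<lambda>x. x $ i + s * x $ j)"
    using assms(2) unfolding allowable_forms_def by force
  then show ?thesis
  proof cases
    case 1
    then show ?thesis by (intro exI[of _ "monom 1 (e i)"]) (simp add: poly_monom degree_monom_eq)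
  next
    case 2
    have "e i \<noteq> e j" using assms(1) 2(1) by (auto dest: injD)
    then have "lead_coeff (monom 1 (e i) + monom s (e j)) \<in> {1, -1}"
      using 2(2) lead[of "e i" "e j" s] by fastforce
    moreover have "l (\<chi> i. t ^ e i) = poly (monom 1 (e i) + monom s (e j)) t" for t
      unfolding 2(3) by (simp add: poly_monom)
    ultimately show ?thesis by blast
  qed
qed

text \<open>Comparing leading coefficients along a monomial curve with distinct exponents, where the product
  of the forms has leading coefficient \<open>1\<close> or \<open>-1\<close>.  Integer values of the polynomial at
  integer points would not be enough: \<open>x * y * (x + y) / 2\<close> takes integer values there.\<close>

lemma factorization_integer:
  fixes p :: "'n::finite int_mpoly"
  assumes "set ls \<subseteq> allowable_forms" and p: "\<And>x. eval_mpoly p x = c * prod_list (map (\<lambda>l. l x) ls)"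
  shows "c \<in> \<int>"
proof -
  obtain e :: "'n \<Rightarrow> nat" where e: "inj e"
    using finite_imp_inj_to_nat_seg[of "UNIV :: 'n set"] by auto
  have "\<exists>Q. lead_coeff Q \<in> {1, -1} \<and>
      (\<forall>t. prod_list (map (\<lambda>l. l (\<chi> i. t ^ e i)) ls) = poly Q t)"
    using assms(1)
  proof (induction ls)
    case Nil
    show ?case by (intro exI[of _ 1]) simp
  next
    case (Cons l ls)
    then have l: "l \<in> allowable_forms" by simp
    obtain Q where Q: "lead_coeff Q \<in> {1, -1}" "\<And>t. l (\<chi> i. t ^ e i) = poly Q t"
      using allowable_form_monomial_curve[OF e l] by blast
    have "\<exists>R. lead_coeff R \<in> {1, -1} \<and>
        (\<forall>t. prod_list (map (\<lambda>l. l (\<chi> i. t ^ e i)) ls) = poly R t)"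
      using Cons by simp
    then obtain R where R: "lead_coeff R \<in> {1, -1}"
      "\<And>t. prod_list (map (\<lambda>l. l (\<chi> i. t ^ e i)) ls) = poly R t" by blast
    have "lead_coeff (Q * R) \<in> {1, -1}" using Q(1) R(1) unfolding lead_coeff_mult by auto
    moreover have "prod_list (map (\<lambda>l. l (\<chi> i. t ^ e i)) (l # ls)) = poly (Q * R) t" for t
      using Q(2)[of t] R(2)[of t] by simp
    ultimately show ?case by blast
  qed
  then obtain Q where Q: "lead_coeff Q \<in> {1, -1}"
    "\<And>t. prod_list (map (\<lambda>l. l (\<chi> i. t ^ e i)) ls) = poly Q t" by blast
  obtain P where P: "\<And>k. coeff P k \<in> \<int>" "\<And>t. eval_mpoly p (\<chi> i. t ^ e i) = poly P t"
    using eval_mpoly_monomial_curve by blast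
  have "poly P t = poly (smult c Q) t" for t using P(2) Q(2) p[of "\<chi> i. t ^ e i"] by simp
  then have "P = smult c Q" using poly_eq_poly_eq_iff by blast
  then have "c * lead_coeff Q \<in> \<int>" using P(1)[of "degree Q"] by simp
  then show ?thesis using Q(1) by auto
qed

section \<open>Straight-line programs\<close>

text \<open>The total counterpart of \<open>operand_value\<close>, for programs in which no value is ever missing.\<close>

fun operand_of :: "complex ^ 'n::finite \<Rightarrow> (nat \<Rightarrow> complex) \<Rightarrow> 'n operand \<Rightarrow> complex" where
  "operand_of x g (Inp i) = x $ i"
| "operand_of x g (Nd m) = g m"

text \<open>A program without branches and without its output node; \<open>G x \<delta> k\<close> is the value of node \<open>k\<close>.
  Describing the values by equations, instead of computing them from the program, makes
  appending a node a local change.\<close>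

definition straight_line ::
  "'n::finite graph \<Rightarrow> (complex ^ 'n \<Rightarrow> (nat \<Rightarrow> complex) \<Rightarrow> nat \<Rightarrow> complex) \<Rightarrow> bool" where
  "straight_line A G \<longleftrightarrow> (\<forall>k<length A. \<exists>f a b. A ! k = Compute f a b (Suc k) \<and>
     {a, b} \<subseteq> range Inp \<union> Nd ` {..<k} \<and>
     (\<forall>x \<delta>. G x \<delta> k = arith_op f (operand_of x (G x \<delta>) a) (operand_of x (G x \<delta>) b) * (1 + \<delta> k)))"

lemma straight_line_node:
  assumes "straight_line A G" "k < length A"
  obtains f a b where "A ! k = Compute f a b (Suc k)" "a \<in> range Inp \<union> Nd ` {..<k}"
    "b \<in> range Inp \<union> Nd ` {..<k}"
    "\<And>x \<delta>. G x \<delta> k = arith_op f (operand_of x (G x \<delta>) a) (operand_of x (G x \<delta>) b) * (1 + \<delta> k)"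
proof -
  have "\<exists>f a b. A ! k = Compute f a b (Suc k) \<and> {a, b} \<subseteq> range Inp \<union> Nd ` {..<k} \<and>
     (\<forall>x \<delta>. G x \<delta> k = arith_op f (operand_of x (G x \<delta>) a) (operand_of x (G x \<delta>) b) * (1 + \<delta> k))"
    using assms(1)[unfolded straight_line_def, rule_format, OF assms(2)] .
  then obtain f a b where "A ! k = Compute f a b (Suc k)" "{a, b} \<subseteq> range Inp \<union> Nd ` {..<k}"
    "\<And>x \<delta>. G x \<delta> k = arith_op f (operand_of x (G x \<delta>) a) (operand_of x (G x \<delta>) b) * (1 + \<delta> k)"
    by blast
  then show ?thesis by (intro that) auto
qed

text \<open>Backwards from the output node: the state reached at node \<open>k\<close> holds the values of all earlier
  nodes.\<close>

lemma straight_line_returns: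
  assumes "straight_line A G" "a \<in> range Inp \<union> Nd ` {..<length A}"
  shows "returns (A @ [Output a]) x \<delta> 0 Map.empty (operand_of x (G x \<delta>) a)"
proof -
  define \<sigma> where "\<sigma> k m = (if m < k then Some (G x \<delta> m) else None)" for k m
  have val: "operand_value x (\<sigma> k) b = Some (operand_of x (G x \<delta>) b)"
    if "b \<in> range Inp \<union> Nd ` {..<k}" for b k
    using that unfolding \<sigma>_def by auto
  have "returns (A @ [Output a]) x \<delta> k (\<sigma> k) (operand_of x (G x \<delta>) a)" if "k \<le> length A" for k
    using that
  proof (induction rule: inc_induct)
    case base
    show ?case by (rule returns.out[where a = a]) (use assms(2) in \<open>simp_all add: val\<close>)
  next
    case (step k)
    obtain f c d where k: "A ! k = Compute f c d (Suc k)" "c \<in> range Inp \<union> Nd ` {..<k}"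
      "d \<in> range Inp \<union> Nd ` {..<k}"
      "\<And>x \<delta>. G x \<delta> k = arith_op f (operand_of x (G x \<delta>) c) (operand_of x (G x \<delta>) d) * (1 + \<delta> k)"
      using straight_line_node[OF assms(1) step.hyps(2)] by metis
    have "\<sigma> (Suc k) = (\<sigma> k)(k \<mapsto> G x \<delta> k)" unfolding \<sigma>_def by (auto simp: fun_eq_iff)
    then have "returns (A @ [Output a]) x \<delta> (Suc k) ((\<sigma> k)(k \<mapsto>
        arith_op f (operand_of x (G x \<delta>) c) (operand_of x (G x \<delta>) d) * (1 + \<delta> k)))
        (operand_of x (G x \<delta>) a)"
      using step.IH k(4)[of x \<delta>] by (simp only:)
    then show ?case
      by (rule returns.compute[OF _ _ val[OF k(2)] val[OF k(3)], rotated 2])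
        (use step.hyps k(1) in \<open>simp_all add: nth_append\<close>)
  qed
  from this[of 0] show ?thesis unfolding \<sigma>_def by simp
qed

lemma straight_line_dag:
  assumes "straight_line A G" "a \<in> range Inp \<union> Nd ` {..<length A}"
  shows "dag (A @ [Output a])"
proof -
  have node: "(k = length A \<and> (A @ [Output a]) ! k = Output a) \<or>
     (k < length A \<and> (\<exists>f c d. (A @ [Output a]) ! k = Compute f c d (Suc k) \<and>
       c \<in> range Inp \<union> Nd ` {..<k} \<and> d \<in> range Inp \<union> Nd ` {..<k}))"
    if "k < length (A @ [Output a])" for k
  proof (cases "k < length A")
    case True
    show ?thesis
      by (rule straight_line_node[OF assms(1) True]) (use True in \<open>auto simp: nth_append\<close>)
  next
    case False
    then have "k = length A" using that by simp
    then show ?thesis by simp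
  qed
  have "i < j \<and> j < Suc (length A)" if "(i, j) \<in> edges (A @ [Output a])" for i j
  proof -
    from that consider
        "i < length (A @ [Output a])" "j \<in> successors ((A @ [Output a]) ! i)"
      | "j < length (A @ [Output a])" "Nd i \<in> operands ((A @ [Output a]) ! j)"
      unfolding edges_def by blast
    then show ?thesis
    proof cases
      case 1
      then show ?thesis using node[of i] by fastforce
    next
      case 2
      then show ?thesis using node[of j] assms(2) by fastforce
    qed
  qed
  then have sub: "edges (A @ [Output a]) \<subseteq> less_than \<inter> {..<Suc (length A)} \<times> {..<Suc (length A)}"
    by force
  then have "acyclic (edges (A @ [Output a]))"
    by (meson acyclic_subset inf.boundedE wf_acyclic wf_less_than)
  then show ?thesis using sub unfolding dag_def by simp
qed

section \<open>Accurate computation of integer multiples of products\<close>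

text \<open>The constant \<open>\<epsilon>\<close> is uniform in the input; the relative form of the bound forces exactness
  where \<open>f\<close> vanishes.\<close>

definition accurate_operand ::
  "'n::finite graph \<Rightarrow> (complex ^ 'n \<Rightarrow> (nat \<Rightarrow> complex) \<Rightarrow> nat \<Rightarrow> complex) \<Rightarrow> 'n operand \<Rightarrow>
    (complex ^ 'n \<Rightarrow> complex) \<Rightarrow> bool" where
  "accurate_operand A G a f \<longleftrightarrow> a \<in> range Inp \<union> Nd ` {..<length A} \<and>
     (\<forall>\<eta>>0. \<exists>\<epsilon>>0. \<forall>x \<delta>. (\<forall>i<length A. cmod (\<delta> i) \<le> \<epsilon>) \<longrightarrow>
        cmod (operand_of x (G x \<delta>) a - f x) \<le> \<eta> * cmod (f x))"

definition extends ::
  "'n::finite graph \<Rightarrow> (complex ^ 'n \<Rightarrow> (nat \<Rightarrow> complex) \<Rightarrow> nat \<Rightarrow> complex) \<Rightarrow>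
   'n graph \<Rightarrow> (complex ^ 'n \<Rightarrow> (nat \<Rightarrow> complex) \<Rightarrow> nat \<Rightarrow> complex) \<Rightarrow> bool" where
  "extends A G A' G' \<longleftrightarrow> length A \<le> length A' \<and> (\<forall>k<length A. \<forall>x \<delta>. G' x \<delta> k = G x \<delta> k)"

lemma extends_trans: "extends A G A' G' \<Longrightarrow> extends A' G' A'' G'' \<Longrightarrow> extends A G A'' G''"
  unfolding extends_def by auto

lemma extends_operand:
  assumes "extends A G A' G'" "a \<in> range Inp \<union> Nd ` {..<length A}"
  shows "a \<in> range Inp \<union> Nd ` {..<length A'}" "operand_of x (G' x \<delta>) a = operand_of x (G x \<delta>) a"
  using assms unfolding extends_def by auto

lemma accurate_operand_extends:
  assumes "accurate_operand A G a f" "extends A G A' G'"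
  shows "accurate_operand A' G' a f"
  unfolding accurate_operand_def
proof (intro conjI allI impI)
  have a: "a \<in> range Inp \<union> Nd ` {..<length A}" using assms(1) unfolding accurate_operand_def by blast
  show "a \<in> range Inp \<union> Nd ` {..<length A'}" using extends_operand(1)[OF assms(2) a] .
  fix \<eta> :: real assume "0 < \<eta>"
  then obtain \<epsilon> where "0 < \<epsilon>" "\<forall>x \<delta>. (\<forall>i<length A. cmod (\<delta> i) \<le> \<epsilon>) \<longrightarrow>
        cmod (operand_of x (G x \<delta>) a - f x) \<le> \<eta> * cmod (f x)"
    using assms(1) unfolding accurate_operand_def by blast
  moreover have "length A \<le> length A'" using assms(2) unfolding extends_def by blast
  ultimately show "\<exists>\<epsilon>>0. \<forall>x \<delta>. (\<forall>i<length A'. cmod (\<delta> i) \<le> \<epsilon>) \<longrightarrow>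
        cmod (operand_of x (G' x \<delta>) a - f x) \<le> \<eta> * cmod (f x)"
    by (intro exI[of _ \<epsilon>]) (auto simp: extends_operand(2)[OF assms(2) a])
qed

lemma straight_line_append:
  assumes A: "straight_line A G" and ab: "{a, b} \<subseteq> range Inp \<union> Nd ` {..<length A}"
  obtains G' where "straight_line (A @ [Compute f a b (Suc (length A))]) G'"
    "extends A G (A @ [Compute f a b (Suc (length A))]) G'"
    "\<And>x \<delta>. G' x \<delta> (length A) =
       arith_op f (operand_of x (G x \<delta>) a) (operand_of x (G x \<delta>) b) * (1 + \<delta> (length A))"
proof -
  define n where "n = length A"
  define G' where "G' x \<delta> = (G x \<delta>)(n :=
    arith_op f (operand_of x (G x \<delta>) a) (operand_of x (G x \<delta>) b) * (1 + \<delta> n))" for x \<delta>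
  have same: "operand_of x (G' x \<delta>) c = operand_of x (G x \<delta>) c"
    if "c \<in> range Inp \<union> Nd ` {..<k}" "k \<le> n" for c x \<delta> k
    using that unfolding G'_def by auto
  have "straight_line (A @ [Compute f a b (Suc n)]) G'"
    unfolding straight_line_def
  proof (intro allI impI)
    fix k assume "k < length (A @ [Compute f a b (Suc n)])"
    then consider "k < n" | "k = n" unfolding n_def by fastforce
    then show "\<exists>g c d. (A @ [Compute f a b (Suc n)]) ! k = Compute g c d (Suc k) \<and>
      {c, d} \<subseteq> range Inp \<union> Nd ` {..<k} \<and> (\<forall>x \<delta>. G' x \<delta> k =
        arith_op g (operand_of x (G' x \<delta>) c) (operand_of x (G' x \<delta>) d) * (1 + \<delta> k))"
    proof cases
      case 1
      then have "k < length A" unfolding n_def .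
      then obtain g c d where g: "A ! k = Compute g c d (Suc k)" "c \<in> range Inp \<union> Nd ` {..<k}"
        "d \<in> range Inp \<union> Nd ` {..<k}" "\<And>x \<delta>. G x \<delta> k =
          arith_op g (operand_of x (G x \<delta>) c) (operand_of x (G x \<delta>) d) * (1 + \<delta> k)"
        using straight_line_node[OF A] by metis
      have "G' x \<delta> k = G x \<delta> k" for x \<delta> using 1 unfolding G'_def by simp
      moreover have "operand_of x (G' x \<delta>) c = operand_of x (G x \<delta>) c"
        "operand_of x (G' x \<delta>) d = operand_of x (G x \<delta>) d" for x \<delta>
        using same[OF g(2)] same[OF g(3)] 1 by simp_all
      ultimately show ?thesis using g(4) g(2,3) 1
        by (intro exI[of _ g] exI[of _ c] exI[of _ d]) (simp add: nth_append n_def g(1))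
    next
      case 2
      have "operand_of x (G' x \<delta>) a = operand_of x (G x \<delta>) a"
        "operand_of x (G' x \<delta>) b = operand_of x (G x \<delta>) b" for x \<delta>
        using same[of _ n] ab unfolding n_def by auto
      moreover have "G' x \<delta> n =
          arith_op f (operand_of x (G x \<delta>) a) (operand_of x (G x \<delta>) b) * (1 + \<delta> n)" for x \<delta>
        unfolding G'_def by simp
      moreover have "(A @ [Compute f a b (Suc n)]) ! n = Compute f a b (Suc n)"
        unfolding n_def by simp
      ultimately show ?thesis using ab unfolding 2 n_def[symmetric]
        by (intro exI[of _ f] exI[of _ a] exI[of _ b]) simp
    qed
  qed
  moreover have "extends A G (A @ [Compute f a b (Suc n)]) G'"
    unfolding extends_def G'_def n_def by simp
  ultimately show ?thesis using that[of G'] unfolding n_def G'_def by simp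
qed

text \<open>Quantifying over the program that is extended makes the notion compose: two such functions can be
  computed one after the other, the second without disturbing the first.\<close>

definition computable :: "(complex ^ 'n::finite \<Rightarrow> complex) \<Rightarrow> bool" where
  "computable f \<longleftrightarrow> (\<forall>A G. straight_line A G \<longrightarrow>
     (\<exists>A' G' a. straight_line A' G' \<and> extends A G A' G' \<and> accurate_operand A' G' a f))"

lemma computable_accurately_evaluable:
  assumes "computable f" shows "accurately_evaluable f UNIV"
proof -
  have "straight_line [] (\<lambda>x \<delta> k. 0)" unfolding straight_line_def by simp
  then obtain A G a where A: "straight_line A G" "accurate_operand A G a f"
    using assms unfolding computable_def by blast
  then have a: "a \<in> range Inp \<union> Nd ` {..<length A}"
    and acc: "\<And>\<eta>. 0 < \<eta> \<Longrightarrow> \<exists>\<epsilon>>0. \<forall>x \<delta>. (\<forall>i<length A. cmod (\<delta> i) \<le> \<epsilon>) \<longrightarrow>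
        cmod (operand_of x (G x \<delta>) a - f x) \<le> \<eta> * cmod (f x)"
    unfolding accurate_operand_def by blast+
  let ?A = "A @ [Output a]"
  have ret: "returns ?A x \<delta> 0 Map.empty (operand_of x (G x \<delta>) a)" for x \<delta>
    using straight_line_returns[OF A(1) a] .
  then have pc: "p_comp ?A x \<delta> = operand_of x (G x \<delta>) a" for x \<delta> using p_comp_eq by blast
  have "algorithm ?A" unfolding algorithm_def using straight_line_dag[OF A(1) a] ret by blast
  moreover have "p_comp ?A x (\<lambda>_. 0) = f x" for x
  proof -
    have "cmod (p_comp ?A x (\<lambda>_. 0) - f x) \<le> 0 + e" if "0 < e" for e
    proof -
      have "0 < e / (cmod (f x) + 1)" using that by (simp add: add_nonneg_pos)
      from acc[OF this] have "cmod (p_comp ?A x (\<lambda>_. 0) - f x) \<le> e / (cmod (f x) + 1) * cmod (f x)"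
        unfolding pc by (auto intro: less_imp_le)
      also have "\<dots> = e * (cmod (f x) / (cmod (f x) + 1))" by simp
      also have "\<dots> \<le> e" using that by (intro mult_left_le) (auto simp: add_nonneg_pos)
      finally show ?thesis by simp
    qed
    then have "cmod (p_comp ?A x (\<lambda>_. 0) - f x) \<le> 0" by (rule field_le_epsilon)
    then show ?thesis by simp
  qed
  moreover have "accurate_on ?A f UNIV"
    unfolding accurate_on_def
  proof (intro allI impI)
    fix \<eta> :: real assume "0 < \<eta> \<and> \<eta> < 1"
    then obtain \<epsilon> where e: "\<epsilon> > 0" "\<And>x \<delta>. (\<forall>i<length A. cmod (\<delta> i) \<le> \<epsilon>) \<Longrightarrow>
        cmod (operand_of x (G x \<delta>) a - f x) \<le> \<eta> * cmod (f x)" using acc by blast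
    show "\<exists>\<epsilon>>0. \<epsilon> < 1 \<and> (\<forall>x\<in>UNIV. \<forall>\<delta>. (\<forall>i<length ?A. cmod (\<delta> i) \<le> \<epsilon>) \<longrightarrow>
            cmod (p_comp ?A x \<delta> - f x) \<le> \<eta> * cmod (f x))"
      unfolding pc using e by (intro exI[of _ "min \<epsilon> (1/2)"]) auto
  qed
  ultimately show ?thesis unfolding accurately_evaluable_def algorithm_for_def by blast
qed

lemma computable_coord: "computable (\<lambda>x. x $ i)"
proof -
  have "accurate_operand A G (Inp i) (\<lambda>x. x $ i)" for A G
    unfolding accurate_operand_def by (auto intro: zero_less_one)
  moreover have "extends A G A G" for A :: "'a graph" and G unfolding extends_def by simp
  ultimately show ?thesis unfolding computable_def by blast
qed

text \<open>Operands that are inputs carry no error, so here even a cancelling difference has only the one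
  relative error of its own node.\<close>

lemma computable_inputs: "computable (\<lambda>x. arith_op f (x $ i) (x $ j))"
  unfolding computable_def
proof (intro allI impI)
  fix A :: "'a graph" and G assume A: "straight_line A G"
  obtain G' where G': "straight_line (A @ [Compute f (Inp i) (Inp j) (Suc (length A))]) G'"
    "extends A G (A @ [Compute f (Inp i) (Inp j) (Suc (length A))]) G'"
    "\<And>x \<delta>. G' x \<delta> (length A) = arith_op f (x $ i) (x $ j) * (1 + \<delta> (length A))"
    using straight_line_append[OF A, of "Inp i" "Inp j" f] by auto
  have "accurate_operand (A @ [Compute f (Inp i) (Inp j) (Suc (length A))]) G' (Nd (length A))
      (\<lambda>x. arith_op f (x $ i) (x $ j))"
    unfolding accurate_operand_def
  proof (intro conjI allI impI)
    fix \<eta> :: real assume "0 < \<eta>"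
    have "cmod (w * (1 + d) - w) = cmod d * cmod w" for w d :: complex
      by (simp add: algebra_simps norm_mult)
    then show "\<exists>\<epsilon>>0. \<forall>x \<delta>. (\<forall>k<length (A @ [Compute f (Inp i) (Inp j) (Suc (length A))]). cmod (\<delta> k) \<le> \<epsilon>) \<longrightarrow>
        cmod (operand_of x (G' x \<delta>) (Nd (length A)) - arith_op f (x $ i) (x $ j)) \<le>
        \<eta> * cmod (arith_op f (x $ i) (x $ j))"
      using \<open>0 < \<eta>\<close> by (intro exI[of _ \<eta>]) (auto simp: G'(3) intro: mult_right_mono)
  qed simp
  then show "\<exists>A' G' a. straight_line A' G' \<and> extends A G A' G' \<and>
      accurate_operand A' G' a (\<lambda>x. arith_op f (x $ i) (x $ j))"
    using G'(1,2) by blast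
qed

text \<open>The assumption says that relative errors \<open>e\<close> of the operands are amplified at most by \<open>K\<close>.
  The rounding of the node itself adds at most \<open>(1 + K * e) * e\<close>, so \<open>(2 * K + 1) * e\<close> bounds
  the total for \<open>e \<le> 1\<close>.\<close>

lemma computable_stable_op:
  assumes f: "computable f" and g: "computable g" and K: "0 \<le> K"
    and stable: "\<And>x u v e. \<lbrakk>0 \<le> e; e \<le> 1; cmod (u - f x) \<le> e * cmod (f x);
        cmod (v - g x) \<le> e * cmod (g x)\<rbrakk> \<Longrightarrow>
      cmod (arith_op p u v - arith_op p (f x) (g x)) \<le> K * e * cmod (arith_op p (f x) (g x))"
  shows "computable (\<lambda>x. arith_op p (f x) (g x))"
  unfolding computable_def
proof (intro allI impI)
  fix A :: "'a graph" and G assume "straight_line A G"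
  then obtain A1 G1 a where 1: "straight_line A1 G1" "extends A G A1 G1" "accurate_operand A1 G1 a f"
    using f unfolding computable_def by blast
  then obtain A2 G2 b where 2: "straight_line A2 G2" "extends A1 G1 A2 G2" "accurate_operand A2 G2 b g"
    using g unfolding computable_def by blast
  have a: "accurate_operand A2 G2 a f" using accurate_operand_extends[OF 1(3) 2(2)] .
  have ab: "{a, b} \<subseteq> range Inp \<union> Nd ` {..<length A2}"
    using a 2(3) unfolding accurate_operand_def by blast
  let ?A = "A2 @ [Compute p a b (Suc (length A2))]"
  obtain G' where G': "straight_line ?A G'" "extends A2 G2 ?A G'"
    "\<And>x \<delta>. G' x \<delta> (length A2) = arith_op p (operand_of x (G2 x \<delta>) a) (operand_of x (G2 x \<delta>) b)
        * (1 + \<delta> (length A2))"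
    using straight_line_append[OF 2(1) ab] by blast
  have "accurate_operand ?A G' (Nd (length A2)) (\<lambda>x. arith_op p (f x) (g x))"
    unfolding accurate_operand_def
  proof (intro conjI allI impI)
    fix \<eta> :: real assume "0 < \<eta>"
    define e where "e = min 1 (\<eta> / (2 * K + 1))"
    have e: "0 < e" "e \<le> 1" using \<open>0 < \<eta>\<close> K unfolding e_def by auto
    have "e * (2 * K + 1) \<le> \<eta> / (2 * K + 1) * (2 * K + 1)"
      using K unfolding e_def by (intro mult_right_mono) auto
    then have e\<eta>: "e * (2 * K + 1) \<le> \<eta>" using K by simp
    obtain \<epsilon>1 where e1: "\<epsilon>1 > 0" "\<And>x \<delta>. (\<forall>i<length A2. cmod (\<delta> i) \<le> \<epsilon>1) \<Longrightarrow>
        cmod (operand_of x (G2 x \<delta>) a - f x) \<le> e * cmod (f x)"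
      using a e(1) unfolding accurate_operand_def by blast
    obtain \<epsilon>2 where e2: "\<epsilon>2 > 0" "\<And>x \<delta>. (\<forall>i<length A2. cmod (\<delta> i) \<le> \<epsilon>2) \<Longrightarrow>
        cmod (operand_of x (G2 x \<delta>) b - g x) \<le> e * cmod (g x)"
      using 2(3) e(1) unfolding accurate_operand_def by blast
    define \<epsilon> where "\<epsilon> = min e (min \<epsilon>1 \<epsilon>2)"
    have "cmod (G' x \<delta> (length A2) - arith_op p (f x) (g x)) \<le> \<eta> * cmod (arith_op p (f x) (g x))"
      if "\<forall>i<length ?A. cmod (\<delta> i) \<le> \<epsilon>" for x \<delta>
    proof -
      define w where "w = arith_op p (operand_of x (G2 x \<delta>) a) (operand_of x (G2 x \<delta>) b)"
      define s where "s = arith_op p (f x) (g x)"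
      define d where "d = \<delta> (length A2)"
      have "cmod (w - s) \<le> K * e * cmod s"
        unfolding w_def s_def
        by (rule stable) (use e e1(2)[of \<delta> x] e2(2)[of \<delta> x] that in \<open>auto simp: \<epsilon>_def\<close>)
      moreover have "cmod d \<le> e" using that unfolding d_def \<epsilon>_def by simp
      moreover have "w * (1 + d) - s = (w - s) + (w - s) * d + s * d" by (simp add: algebra_simps)
      then have "cmod (w * (1 + d) - s) \<le> cmod (w - s) + cmod (w - s) * cmod d + cmod s * cmod d"
        by (metis norm_mult norm_triangle_le norm_triangle_ineq add_mono order_refl)
      moreover have "cmod (w - s) * cmod d \<le> cmod (w - s)"
        using \<open>cmod d \<le> e\<close> e(2) by (intro mult_left_le) auto
      moreover have "cmod s * cmod d \<le> cmod s * e" using \<open>cmod d \<le> e\<close> by (intro mult_left_mono) auto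
      ultimately have "cmod (w * (1 + d) - s) \<le> e * (2 * K + 1) * cmod s" by (simp add: algebra_simps)
      also have "\<dots> \<le> \<eta> * cmod s" using e\<eta> by (intro mult_right_mono) auto
      finally show ?thesis unfolding G'(3) w_def s_def d_def .
    qed
    moreover have "0 < \<epsilon>" using e e1(1) e2(1) unfolding \<epsilon>_def by simp
    ultimately show "\<exists>\<epsilon>>0. \<forall>x \<delta>. (\<forall>i<length ?A. cmod (\<delta> i) \<le> \<epsilon>) \<longrightarrow>
        cmod (operand_of x (G' x \<delta>) (Nd (length A2)) - arith_op p (f x) (g x))
          \<le> \<eta> * cmod (arith_op p (f x) (g x))"
      by (intro exI[of _ \<epsilon>]) (simp only: operand_of.simps, blast)
  qed simp
  then show "\<exists>A' G' a. straight_line A' G' \<and> extends A G A' G' \<and>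
      accurate_operand A' G' a (\<lambda>x. arith_op p (f x) (g x))"
    using G'(1,2) 1(2) 2(2) extends_trans by blast
qed

lemma computable_mult:
  assumes "computable f" "computable g" shows "computable (\<lambda>x. f x * g x)"
proof -
  have "computable (\<lambda>x. arith_op Times (f x) (g x))"
  proof (rule computable_stable_op[OF assms, of 3])
    fix x u v and e :: real
    assume e: "0 \<le> e" "e \<le> 1" and u: "cmod (u - f x) \<le> e * cmod (f x)"
      and v: "cmod (v - g x) \<le> e * cmod (g x)"
    have "u * v - f x * g x = (u - f x) * (v - g x) + (u - f x) * g x + f x * (v - g x)"
      by (simp add: algebra_simps)
    then have "cmod (u * v - f x * g x) \<le> cmod (u - f x) * cmod (v - g x)
        + cmod (u - f x) * cmod (g x) + cmod (f x) * cmod (v - g x)"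
      by (metis norm_mult norm_triangle_le norm_triangle_ineq add_mono order_refl)
    also have "\<dots> \<le> e * cmod (f x) * (1 * cmod (g x)) + e * cmod (f x) * cmod (g x)
        + cmod (f x) * (e * cmod (g x))"
      using u v e by (intro add_mono mult_mono order.trans[OF v mult_right_mono]) auto
    finally show "cmod (arith_op Times u v - arith_op Times (f x) (g x))
        \<le> 3 * e * cmod (arith_op Times (f x) (g x))"
      by (simp add: norm_mult algebra_simps)
  qed simp
  then show ?thesis by simp
qed

text \<open>The arithmetic has no constants, so multiples are built from \<open>0 = x - x\<close>, which is exact on inputs,
  by adding \<open>f\<close> to nonnegative multiples and subtracting it from nonpositive ones.  The summands
  then have the same direction, so that the absolute errors add up to no more than \<open>e\<close> times the
  modulus of the result.\<close>

lemma computable_int_multiple: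
  assumes f: "computable f" shows "computable (\<lambda>x. of_int k * f x)"
proof (induction k rule: int_induct[of _ 0])
  case base
  have "computable (\<lambda>x::complex ^ 'a. arith_op Minus (x $ undefined) (x $ undefined))"
    by (rule computable_inputs)
  then show ?case by simp
next
  case (step1 k)
  have "computable (\<lambda>x. arith_op Plus (of_int k * f x) (f x))"
  proof (rule computable_stable_op[OF step1(2) f, of 1])
    fix x u v and e :: real
    assume u: "cmod (u - of_int k * f x) \<le> e * cmod (of_int k * f x)"
      and v: "cmod (v - f x) \<le> e * cmod (f x)"
    have "cmod (u + v - (of_int k * f x + f x)) \<le> cmod (u - of_int k * f x) + cmod (v - f x)"
      using norm_triangle_ineq[of "u - of_int k * f x" "v - f x"] by (simp add: algebra_simps)
    also have "\<dots> \<le> e * (of_int (k + 1) * cmod (f x))"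
      using u v step1(1) by (simp add: norm_mult algebra_simps)
    also have "of_int (k + 1) * cmod (f x) = cmod (of_int (k + 1) * f x)"
      using step1(1) by (simp only: norm_mult norm_of_int)
    finally show "cmod (arith_op Plus u v - arith_op Plus (of_int k * f x) (f x))
        \<le> 1 * e * cmod (arith_op Plus (of_int k * f x) (f x))"
      by (simp add: algebra_simps)
  qed simp
  then show ?case by (simp add: algebra_simps)
next
  case (step2 k)
  have "computable (\<lambda>x. arith_op Minus (of_int k * f x) (f x))"
  proof (rule computable_stable_op[OF step2(2) f, of 1])
    fix x u v and e :: real
    assume u: "cmod (u - of_int k * f x) \<le> e * cmod (of_int k * f x)"
      and v: "cmod (v - f x) \<le> e * cmod (f x)"
    have "cmod (u - v - (of_int k * f x - f x)) \<le> cmod (u - of_int k * f x) + cmod (v - f x)"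
      using norm_triangle_ineq4[of "u - of_int k * f x" "v - f x"] by (simp add: algebra_simps)
    also have "\<dots> \<le> e * (of_int (1 - k) * cmod (f x))"
      using u v step2(1) by (simp add: norm_mult algebra_simps)
    also have "of_int (1 - k) * cmod (f x) = cmod (of_int (k - 1) * f x)"
    proof -
      have "\<bar>real_of_int (k - 1)\<bar> = real_of_int (1 - k)"
        unfolding of_int_abs[symmetric] using step2(1) by simp
      then show ?thesis by (simp only: norm_mult norm_of_int)
    qed
    finally show "cmod (arith_op Minus u v - arith_op Minus (of_int k * f x) (f x))
        \<le> 1 * e * cmod (arith_op Minus (of_int k * f x) (f x))"
      by (simp add: algebra_simps)
  qed simp
  then show ?case by (simp add: algebra_simps)
qed

lemma computable_allowable_form: "l \<in> allowable_forms \<Longrightarrow> computable l"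
  using computable_coord computable_inputs[of Plus] computable_inputs[of Minus]
  unfolding allowable_forms_def by auto

lemma computable_prod_list:
  assumes "ls \<noteq> []" "\<And>l. l \<in> set ls \<Longrightarrow> computable l"
  shows "computable (\<lambda>x. prod_list (map (\<lambda>l. l x) ls))"
  using assms by (induction ls rule: list_nonempty_induct) (auto intro: computable_mult)

section \<open>The characterization\<close>

lemma eval_mpoly_zero:
  assumes "Poly_Mapping.lookup p 0 = 0"
  shows "eval_mpoly p 0 = 0"
  unfolding eval_mpoly_def
proof (rule sum.neutral, intro ballI)
  fix m assume "m \<in> Poly_Mapping.keys p"
  then have "m \<noteq> 0" using assms by (metis in_keys_iff)
  then obtain i where "Poly_Mapping.lookup m i \<noteq> 0" by (metis lookup_zero poly_mapping_eqI)
  then have "(\<Prod>i\<in>UNIV. (0 :: complex ^ 'a) $ i ^ Poly_Mapping.lookup m i) = 0"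
    by (intro prod_zero) auto
  then show "of_int (Poly_Mapping.lookup p m) * (\<Prod>i\<in>UNIV. (0 :: complex ^ 'a) $ i ^ Poly_Mapping.lookup m i) = 0"
    by simp
qed

theorem theorem3p12:
  fixes p :: "'n::finite int_mpoly"
  assumes "Poly_Mapping.lookup p 0 = 0"
  shows "accurately_evaluable (eval_mpoly p) UNIV \<longleftrightarrow> allowable (variety p)"
proof
  assume acc: "accurately_evaluable (eval_mpoly p) UNIV"
  show "allowable (variety p)"
    unfolding variety_def
    by (rule allowable_if_vanishing_transfers[OF polyfun_eval_mpoly])
      (rule accurate_zero_transfer[OF acc])
next
  assume allow: "allowable (variety p)"
  have "\<exists>c ls. ls \<noteq> [] \<and> set ls \<subseteq> allowable_forms \<and>
      (\<forall>x. eval_mpoly p x = of_int c * prod_list (map (\<lambda>l. l x) ls))"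
  proof (cases "\<exists>x. eval_mpoly p x \<noteq> 0")
    case False
    \<comment> \<open>The zero polynomial is \<open>0\<close> times any coordinate.\<close>
    have "(\<lambda>x. x $ undefined) \<in> (allowable_forms :: (complex ^ 'n \<Rightarrow> complex) set)"
      by (auto simp: allowable_forms_def)
    moreover have "eval_mpoly p x = of_int 0 * prod_list (map (\<lambda>l. l x) [\<lambda>x. x $ undefined])" for x
      using False by simp
    ultimately show ?thesis
      by (intro exI[of _ 0] exI[of _ "[\<lambda>x. x $ undefined]"] conjI allI) simp_all
  next
    case True
    have zeros: "\<exists>l\<in>allowable_forms. l x = 0" if "eval_mpoly p x = 0" for x
      using allowable_zeros_on_hyperplanes[OF allow[unfolded variety_def] True that] .
    obtain c ls where ls: "set ls \<subseteq> allowable_forms"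
      "\<And>x. eval_mpoly p x = c * prod_list (map (\<lambda>l. l x) ls)"
      by (rule factorization[OF finite_allowable_forms _ _ polyfun_eval_mpoly True zeros])
        (assumption | rule linear_form_allowable allowable_form_nonzero | blast)+
    have "c \<in> \<int>" using factorization_integer[OF ls] .
    then obtain k where k: "c = of_int k" by (rule Ints_cases)
    \<comment> \<open>An empty product would make \<open>p\<close> a constant, which the origin shows to be zero.\<close>
    have "ls \<noteq> []"
    proof
      assume "ls = []"
      then have "eval_mpoly p x = c" for x using ls(2)[of x] by simp
      then have "eval_mpoly p x = eval_mpoly p 0" for x by simp
      then show False using True eval_mpoly_zero[OF assms] by simp
    qed
    moreover have "\<forall>x. eval_mpoly p x = of_int k * prod_list (map (\<lambda>l. l x) ls)"
      using ls(2) unfolding k by simp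
    ultimately show ?thesis using ls(1) by (intro exI[of _ k] exI[of _ ls] conjI)
  qed
  then obtain c ls where ls: "ls \<noteq> []" "set ls \<subseteq> allowable_forms"
      "\<forall>x. eval_mpoly p x = of_int c * prod_list (map (\<lambda>l. l x) ls)" by (elim exE conjE)
  have "computable (\<lambda>x. of_int c * prod_list (map (\<lambda>l. l x) ls))"
    using ls(2)
    by (intro computable_int_multiple computable_prod_list[OF ls(1)] computable_allowable_form) (rule subsetD)
  moreover have "eval_mpoly p = (\<lambda>x. of_int c * prod_list (map (\<lambda>l. l x) ls))" using ls(3) by (intro ext) simp
  ultimately show "accurately_evaluable (eval_mpoly p) UNIV"
    by (simp only: computable_accurately_evaluable)
qed

end
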